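(* Let $K$ be an oriented knot in an integral homology 3-sphere $\Sigma$ with exterior $N_K$, let $n\ge 1$, and let $\alpha\colon \pi_1(N_K)\to \mathrm{SL}(n,\mathbb{C})$ be an irreducible representation. Then the character $\xi_\alpha\in X_n(N_K)$ is fixed under the action of $\mathbb{Z}/n$ on $X_n(N_K)$ if and only if $\alpha$ is metabelian.
   Context: A knot $K$ is an oriented simple closed curve in an integral homology 3-sphere $\Sigma$; $N_K=\Sigma\smallsetminus\tau(K)$, where $\tau(K)$ is an open tubular neighborhood of $K$. Let $\varepsilon\colon\pi_1(N_K)\to H_1(N_K)=\mathbb{Z}$ be the abelianization, with the identification $H_1(N_K)=\mathbb{Z}$ determined by the orientation of $K$ (so a meridian $\mu$ of $K$ has $\varepsilon(\mu)=1$). $R_n(N_K)$ is the space of representations $\pi_1(N_K)\to\mathrm{SL}(n,\mathbb{C})$. For $\alpha\in R_n(N_K)$ its character is $\xi_\alpha\colon\pi_1(N_K)\to\mathbb{C}$, $\xi_\alpha(g)=\operatorname{tr}\alpha(g)$, and $X_n(N_K)$ is the $\mathrm{SL}(n,\mathbb{C})$ character variety, whose points are the characters $\xi_\alpha$, $\alpha\in R_n(N_K)$. Action of $\mathbb{Z}/n=\langle\sigma\mid\sigma^n=1\rangle$: with $\omega=e^{2\pi i/n}$, set $(\sigma\cdot\alpha)(g)=\omega^{\varepsilon(g)}\alpha(g)$ for $g\in\pi_1(N_K)$. This is an action on $R_n(N_K)$ and it descends to $X_n(N_K)$ by $\sigma\cdot\xi_\alpha=\xi_{\sigma\cdot\alpha}$.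 For a group $\pi$, put $\pi^{(0)}=\pi$ and $\pi^{(i+1)}=[\pi^{(i)},\pi^{(i)}]$. A representation of $\pi$ is called metabelian if it factors through $\pi/\pi^{(2)}$. *)

theory Defs
  imports "HOL-Analysis.Analysis" "HOL-Homology.Homology" "HOL-Algebra.Generated_Groups" "HOL-Algebra.Group_Action"
begin

text \<open>The fundamental group of an abstract topology. Loops are functions on the reals of which
  only the restriction to the unit interval matters; homotopies fix the end points.\<close>

definition loops_at :: "'a topology \<Rightarrow> 'a \<Rightarrow> (real \<Rightarrow> 'a) set" where
  "loops_at X x = {f. pathin X f \<and> f 0 = x \<and> f 1 = x}"

definition loop_class :: "'a topology \<Rightarrow> 'a \<Rightarrow> (real \<Rightarrow> 'a) \<Rightarrow> (real \<Rightarrow> 'a) set" where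
  "loop_class X x f =
     {g. homotopic_with (\<lambda>h. h 0 = x \<and> h 1 = x) (top_of_set {0..1}) X f g}"

definition path_concat :: "(real \<Rightarrow> 'a) \<Rightarrow> (real \<Rightarrow> 'a) \<Rightarrow> real \<Rightarrow> 'a" where
  "path_concat f g = (\<lambda>t. if t \<le> 1/2 then f (2 * t) else g (2 * t - 1))"

definition path_reverse :: "(real \<Rightarrow> 'a) \<Rightarrow> real \<Rightarrow> 'a" where
  "path_reverse f = (\<lambda>t. f (1 - t))"

definition fundamental_group :: "'a topology \<Rightarrow> 'a \<Rightarrow> (real \<Rightarrow> 'a) set monoid" where
  "fundamental_group X x =
     \<lparr>carrier = loop_class X x ` loops_at X x,
      monoid.mult = (\<lambda>A B. \<Union>f\<in>A. \<Union>g\<in>B. loop_class X x (path_concat f g)),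
      one = loop_class X x (\<lambda>_. x)\<rparr>"

text \<open>Second countability of a closed manifold follows from compactness, connectedness of a
  homology sphere from the case \<^term>\<open>p = 0\<close>.\<close>

definition closed_3_manifold :: "'a topology \<Rightarrow> bool" where
  "closed_3_manifold X \<longleftrightarrow> compact_space X \<and> Hausdorff_space X \<and>
     (\<forall>x\<in>topspace X. \<exists>U. openin X U \<and> x \<in> U \<and>
        subtopology X U homeomorphic_space (euclidean :: (real^3) topology))"

definition integral_homology_3_sphere :: "'a topology \<Rightarrow> bool" where
  "integral_homology_3_sphere X \<longleftrightarrow> closed_3_manifold X \<and>
     (\<forall>p. homology_group p X \<cong> homology_group p (nsphere 3))"

text \<open>An oriented simple closed curve is given by a parametrisation of it by the unit circle, the
  latter being oriented counterclockwise.\<close>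

definition oriented_knot :: "'a topology \<Rightarrow> (complex \<Rightarrow> 'a) \<Rightarrow> bool" where
  "oriented_knot X k \<longleftrightarrow> embedding_map (top_of_set (sphere 0 1)) X k"

text \<open>A framed open tube around the knot. The open tubular neighbourhood itself is the image of
  the circle times the open unit disc, so that it is collared inside a larger tube; this excludes
  wild knots and wildly embedded boundary tori. The ambient orientation is the one for which
  \<open>T\<close> preserves orientation, and both ambient orientations arise from tubes of
  the same oriented knot (replace \<open>T (z, w)\<close> by \<open>T (z, cnj w)\<close>).\<close>

definition tube :: "'a topology \<Rightarrow> (complex \<Rightarrow> 'a) \<Rightarrow> (complex \<times> complex \<Rightarrow> 'a) \<Rightarrow> bool" where
  "tube X k T \<longleftrightarrow>
     embedding_map (top_of_set (sphere 0 1 \<times> UNIV)) X T \<and>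
     open_map (top_of_set (sphere 0 1 \<times> UNIV)) X T \<and>
     (\<forall>z\<in>sphere 0 1. T (z, 0) = k z)"

definition knot_exterior :: "'a topology \<Rightarrow> (complex \<times> complex \<Rightarrow> 'a) \<Rightarrow> 'a topology" where
  "knot_exterior X T = subtopology X (topspace X - T ` (sphere 0 1 \<times> ball 0 1))"

text \<open>A meridian is a positively oriented boundary of a fibre disc, joined to the base point by an
  arbitrary path in the exterior.\<close>

definition meridians ::
    "'a topology \<Rightarrow> (complex \<times> complex \<Rightarrow> 'a) \<Rightarrow> 'a \<Rightarrow> (real \<Rightarrow> 'a) set set" where
  "meridians X T x =
     {loop_class (knot_exterior X T) x
        (path_concat c (path_concat (\<lambda>t. T (1, cis (2 * pi * t))) (path_reverse c))) | c.
        pathin (knot_exterior X T) c \<and> c 0 = x \<and> c 1 = T (1, 1)}"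

text \<open>The abelianization onto the integers, with the sign fixed by the meridians. By the
  Hurewicz theorem the quotient by the commutator subgroup is the first homology group. These
  conditions determine \<open>\<epsilon>\<close> uniquely on the fundamental group.\<close>

definition knot_abelianization :: "'a topology \<Rightarrow> (complex \<times> complex \<Rightarrow> 'a) \<Rightarrow> 'a \<Rightarrow>
    ((real \<Rightarrow> 'a) set \<Rightarrow> int) \<Rightarrow> bool" where
  "knot_abelianization X T x \<epsilon> \<longleftrightarrow>
     (let \<pi> = fundamental_group (knot_exterior X T) x in
        \<epsilon> \<in> epi \<pi> integer_group \<and>
        kernel \<pi> integer_group \<epsilon> = derived \<pi> (carrier \<pi>) \<and>
        (\<forall>\<mu>\<in>meridians X T x. \<epsilon> \<mu> = 1))"

definition SL :: "(complex^'n^'n) monoid" where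
  "SL = \<lparr>carrier = {A. det A = 1}, monoid.mult = (**), one = mat 1\<rparr>"

definition rep_variety :: "('g, 'm) monoid_scheme \<Rightarrow> ('g \<Rightarrow> complex^'n^'n) set" where
  "rep_variety G = hom G SL"

definition irreducible_rep :: "('g, 'm) monoid_scheme \<Rightarrow> ('g \<Rightarrow> complex^'n^'n) \<Rightarrow> bool" where
  "irreducible_rep G \<alpha> \<longleftrightarrow> \<alpha> \<in> rep_variety G \<and>
     (\<forall>W. vec.subspace W \<and> (\<forall>g\<in>carrier G. \<forall>w\<in>W. \<alpha> g *v w \<in> W) \<longrightarrow> W = {0} \<or> W = UNIV)"

definition metabelian_rep :: "('g, 'm) monoid_scheme \<Rightarrow> ('g \<Rightarrow> complex^'n^'n) \<Rightarrow> bool" where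
  "metabelian_rep G \<alpha> \<longleftrightarrow> \<alpha> \<in> rep_variety G \<and>
     (let D = (derived G ^^ 2) (carrier G) in
        \<exists>\<beta>\<in>hom (G Mod D) SL. \<forall>g\<in>carrier G. \<alpha> g = \<beta> (D #>\<^bsub>G\<^esub> g))"

definition character :: "('g, 'm) monoid_scheme \<Rightarrow> ('g \<Rightarrow> complex^'n^'n) \<Rightarrow> 'g \<Rightarrow> complex" where
  "character G \<alpha> = (\<lambda>g\<in>carrier G. trace (\<alpha> g))"

text \<open>The dimension cannot be read off from a function to the complex numbers, so
  the character variety and the action on it carry the index type explicitly.\<close>

definition char_variety :: "'n::finite itself \<Rightarrow> ('g, 'm) monoid_scheme \<Rightarrow> ('g \<Rightarrow> complex) set" where
  "char_variety _ G = character G ` (rep_variety G :: ('g \<Rightarrow> complex^'n^'n) set)"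

text \<open>The action of the class of \<open>j\<close> modulo \<open>n\<close>, that is, of the
  \<open>j\<close>-th power of the generator.\<close>

definition rep_action :: "('g \<Rightarrow> int) \<Rightarrow> int \<Rightarrow> ('g \<Rightarrow> complex^'n^'n) \<Rightarrow> 'g \<Rightarrow> complex^'n^'n" where
  "rep_action \<epsilon> j \<alpha> =
     (\<lambda>g. \<chi> r s. cis (2 * pi / real CARD('n)) powi (j * \<epsilon> g) * \<alpha> g $ r $ s)"

definition char_action :: "'n::finite itself \<Rightarrow> ('g, 'm) monoid_scheme \<Rightarrow> ('g \<Rightarrow> int) \<Rightarrow> int \<Rightarrow>
    ('g \<Rightarrow> complex) \<Rightarrow> 'g \<Rightarrow> complex" where
  "char_action _ G \<epsilon> j = (\<lambda>\<xi>\<in>char_variety TYPE('n) G. THE \<eta>.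
     \<exists>\<alpha>\<in>(rep_variety G :: ('g \<Rightarrow> complex^'n^'n) set).
        \<xi> = character G \<alpha> \<and> \<eta> = character G (rep_action \<epsilon> j \<alpha>))"

text \<open>The action on characters is well defined, so the description operator above denotes.\<close>

lemma trace_rep_action: "trace (rep_action \<epsilon> j \<alpha> g :: complex^'n^'n) =
    cis (2 * pi / real CARD('n)) powi (j * \<epsilon> g) * trace (\<alpha> g)"
  by (simp add: trace_def rep_action_def sum_distrib_left)

lemma char_action_character:
  fixes \<alpha> :: "'g \<Rightarrow> complex^'n^'n"
  assumes "\<alpha> \<in> rep_variety G"
  shows "char_action TYPE('n) G \<epsilon> j (character G \<alpha>) = character G (rep_action \<epsilon> j \<alpha>)"
proof -
  have "character G \<alpha> \<in> char_variety TYPE('n) G" using assms by (auto simp: char_variety_def)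
  moreover have "(THE \<eta>. \<exists>\<alpha>'\<in>(rep_variety G :: ('g \<Rightarrow> complex^'n^'n) set).
        character G \<alpha> = character G \<alpha>' \<and> \<eta> = character G (rep_action \<epsilon> j \<alpha>')) = character G (rep_action \<epsilon> j \<alpha>)"
  proof (rule the_equality)
    show "\<exists>\<alpha>'\<in>(rep_variety G :: ('g \<Rightarrow> complex^'n^'n) set).
        character G \<alpha> = character G \<alpha>' \<and> character G (rep_action \<epsilon> j \<alpha>) = character G (rep_action \<epsilon> j \<alpha>')"
      using assms by blast
    fix \<eta> assume "\<exists>\<alpha>'\<in>(rep_variety G :: ('g \<Rightarrow> complex^'n^'n) set).
        character G \<alpha> = character G \<alpha>' \<and> \<eta> = character G (rep_action \<epsilon> j \<alpha>')"
    then obtain \<beta> :: "'g \<Rightarrow> complex^'n^'n" where b: "character G \<alpha> = character G \<beta>" "\<eta> = character G (rep_action \<epsilon> j \<beta>)" by blast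
    have "trace (\<alpha> g) = trace (\<beta> g)" if "g \<in> carrier G" for g
      using fun_cong[OF b(1), of g] that by (simp add: character_def)
    thus "\<eta> = character G (rep_action \<epsilon> j \<alpha>)"
      unfolding b(2) character_def by (intro restrict_ext) (simp add: trace_rep_action)
  qed
  ultimately show ?thesis by (simp add: char_action_def)
qed

definition fixed_character ::
    "'n::finite itself \<Rightarrow> ('g, 'm) monoid_scheme \<Rightarrow> ('g \<Rightarrow> int) \<Rightarrow> ('g \<Rightarrow> complex) \<Rightarrow> bool" where
  "fixed_character N G \<epsilon> \<xi> \<longleftrightarrow>
     (\<forall>j\<in>carrier (integer_mod_group CARD('n)).
        \<xi> \<in> invariants (char_variety N G) (char_action N G \<epsilon>) j)"

end

theory Submission
  imports Defs "HOL-Computational_Algebra.Fundamental_Theorem_Algebra"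
begin

text \<open>For a fixed irreducible character, \<open>\<alpha>\<close> and its twist by \<open>\<omega>\<^sup>\<epsilon>\<close> are irreducible with the same
  trace, hence conjugate by some \<open>A\<close>. Translating one eigenvector of \<open>A\<close> by powers of a meridian
  produces \<open>n\<close> distinct eigenvalues; the image of the commutator subgroup commutes with \<open>A\<close>, so it is
  diagonal in the resulting basis and therefore abelian.

  Conversely, if the image of the commutator subgroup is abelian, a weight vector for it that is also
  an eigenvector of the first power of the meridian preserving its weight has translates spanning an
  invariant subspace. By irreducibility the orbit of weights has exactly \<open>n\<close> elements, and scaling
  the \<open>i\<close>-th translate by \<open>\<omega>\<^sup>i\<close> conjugates \<open>\<alpha>\<close> into its twist.\<close>

subsection \<open>The fundamental group\<close>

text \<open>The twist factor \<open>\<omega>^\<epsilon>\<close> is trivial exactly where it must be: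
  \<open>\<epsilon>\<close> vanishes on the commutator subgroup, so an intertwiner of
  \<open>\<alpha>\<close> with its twist commutes with the image of that subgroup. Instead the trace
  form is shown to be nondegenerate on the linear span of an irreducible image. Then
  \<open>\<alpha> g \<mapsto> \<beta> g\<close> extends to a bijection of the spans, and a matrix of
  rank one in the span turns this bijection into a linear map of vectors. In the converse direction
  weight spaces may a priori have dimension above one, so a translate that returns to the initial
  weight need not be a multiple of the initial vector. This is why the vector is also made an
  eigenvector of the returning power of the meridian: its translates then close up to a scalar.
  Scaling by powers of \<open>\<omega>\<close> is compatible with closing up because the period is
  \<open>n\<close> and the \<open>n\<close>-th power of \<open>\<omega>\<close> is 1.\<close>

abbreviation loop_homotopic :: "'a topology \<Rightarrow> 'a \<Rightarrow> (real \<Rightarrow> 'a) \<Rightarrow> (real \<Rightarrow> 'a) \<Rightarrow> bool" where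
  "loop_homotopic X x \<equiv> homotopic_with (\<lambda>h. h 0 = x \<and> h 1 = x) (top_of_set {0..1}) X"

text \<open>Self-homotopy is the working form of membership: a homotopy lemma applied to equal
  arguments shows that a construction on loops yields a loop.\<close>

lemma loops_at_iff: "f \<in> loops_at X x \<longleftrightarrow> loop_homotopic X x f f"
  by (auto simp: loops_at_def pathin_def)

lemma loop_homotopic_imp_loops_at:
  assumes "loop_homotopic X x f g"
  shows "f \<in> loops_at X x" "g \<in> loops_at X x"
  using homotopic_with_trans[OF assms homotopic_with_symD[OF assms]]
    homotopic_with_trans[OF homotopic_with_symD[OF assms] assms]
  by (simp_all only: loops_at_iff)

lemma loop_class_eqI:
  assumes "loop_homotopic X x f g"
  shows "loop_class X x f = loop_class X x g"
  unfolding loop_class_def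
  using homotopic_with_trans[OF assms] homotopic_with_trans[OF homotopic_with_symD[OF assms]] by blast

text \<open>The segment from \<open>\<phi> t\<close> to \<open>\<psi> t\<close> stays in the unit
  interval by convexity, and \<open>f\<close> carries it to a homotopy. The end values may be any
  parameters at which \<open>f\<close> is \<open>x\<close>. Reversal, associativity, unit and
  inverses are all instances.\<close>

lemma loop_homotopic_reparametrize:
  assumes f: "f \<in> loops_at X x"
    and phi: "continuous_on {0..1} \<phi>" "\<phi> ` {0..1} \<subseteq> {0..1}"
    and psi: "continuous_on {0..1} \<psi>" "\<psi> ` {0..1} \<subseteq> {0..1}"
    and ends: "f (\<phi> 0) = x" "f (\<phi> 1) = x" "\<phi> 0 = \<psi> 0" "\<phi> 1 = \<psi> 1"
  shows "loop_homotopic X x (\<lambda>t. f (\<phi> t)) (\<lambda>t. f (\<psi> t))"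
proof -
  let ?c = "\<lambda>p::real \<times> real. (1 - fst p) * \<phi> (snd p) + fst p * \<psi> (snd p)"
  have "continuous_on ({0..1} \<times> {0..1}) ?c"
    by (intro continuous_intros continuous_on_compose2[OF phi(1)] continuous_on_compose2[OF psi(1)]) auto
  moreover have "?c (s, t) \<in> {0..1}" if "s \<in> {0..1}" "t \<in> {0..1}" for s t
  proof -
    have "\<phi> t \<in> {0..1}" "\<psi> t \<in> {0..1}" using that phi(2) psi(2) by blast+
    then show ?thesis
      using convexD_alt[of "{0..1::real}" "\<phi> t" "\<psi> t" s] that by simp
  qed
  ultimately have "continuous_map (prod_topology (top_of_set {0..1}) (top_of_set {0..1})) (top_of_set {0..1}) ?c"
    by (simp only: prod_topology_subtopology_eu continuous_map_subtopology_eu) auto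
  from continuous_map_compose[OF this, of X f] f
  have "continuous_map (prod_topology (top_of_set {0..1}) (top_of_set {0..1})) X (f \<circ> ?c)"
    by (simp add: loops_at_def pathin_def)
  then show ?thesis
    unfolding homotopic_with_def using ends
    by (intro exI[of _ "f \<circ> ?c"]) (auto simp: algebra_simps)
qed

lemma loop_homotopic_concat:
  assumes "loop_homotopic X x f f'" "loop_homotopic X x g g'"
  shows "loop_homotopic X x (path_concat f g) (path_concat f' g')"
proof -
  let ?I = "top_of_set {0..1::real}"
  obtain h where h: "continuous_map (prod_topology ?I ?I) X h"
      "\<And>t. h (0, t) = f t" "\<And>t. h (1, t) = f' t"
      "\<And>s. s \<in> {0..1} \<Longrightarrow> h (s, 0) = x \<and> h (s, 1) = x"
    using assms(1) by (auto simp: homotopic_with_def)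
  obtain k where k: "continuous_map (prod_topology ?I ?I) X k"
      "\<And>t. k (0, t) = g t" "\<And>t. k (1, t) = g' t"
      "\<And>s. s \<in> {0..1} \<Longrightarrow> k (s, 0) = x \<and> k (s, 1) = x"
    using assms(2) by (auto simp: homotopic_with_def)
  \<comment> \<open>The two homotopies run side by side on the halves of the loop parameter; on the
    seam \<open>1/2\<close> both are at \<open>x\<close>.\<close>
  define H where "H = (\<lambda>p. if snd p \<le> 1/2 then (h \<circ> (\<lambda>p. (fst p, 2 * snd p))) p
      else (k \<circ> (\<lambda>p. (fst p, 2 * snd p - 1))) p)"
  have "continuous_map (prod_topology ?I ?I) X H"
    unfolding H_def
  proof (rule continuous_map_cases_le)
    show "continuous_map (prod_topology ?I ?I) euclideanreal snd"
      using continuous_map_snd continuous_map_in_subtopology by blast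
    show "continuous_map (subtopology (prod_topology ?I ?I)
        {p \<in> topspace (prod_topology ?I ?I). snd p \<le> 1/2}) X (h \<circ> (\<lambda>p. (fst p, 2 * snd p)))"
      by (rule continuous_map_compose[OF _ h(1)])
        (simp only: prod_topology_subtopology_eu subtopology_subtopology continuous_map_subtopology_eu
            topspace_subtopology, intro conjI continuous_intros, auto)
    show "continuous_map (subtopology (prod_topology ?I ?I)
        {p \<in> topspace (prod_topology ?I ?I). 1/2 \<le> snd p}) X (k \<circ> (\<lambda>p. (fst p, 2 * snd p - 1)))"
      by (rule continuous_map_compose[OF _ k(1)])
        (simp only: prod_topology_subtopology_eu subtopology_subtopology continuous_map_subtopology_eu
            topspace_subtopology, intro conjI continuous_intros, auto)
    fix p :: "real \<times> real"
    assume "p \<in> topspace (prod_topology ?I ?I)" "snd p = 1/2"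
    then obtain s where "p = (s, 1/2)" "s \<in> {0..1}" by (cases p) auto
    then show "(h \<circ> (\<lambda>p. (fst p, 2 * snd p))) p = (k \<circ> (\<lambda>p. (fst p, 2 * snd p - 1))) p"
      using h(4) k(4) by simp
  qed simp
  then show ?thesis
    unfolding homotopic_with_def using h k
    by (intro exI[of _ H]) (auto simp: H_def path_concat_def)
qed

lemma path_concat_loops_at:
  "f \<in> loops_at X x \<Longrightarrow> g \<in> loops_at X x \<Longrightarrow> path_concat f g \<in> loops_at X x"
  unfolding loops_at_iff by (rule loop_homotopic_concat)

lemma path_reverse_loops_at:
  assumes "f \<in> loops_at X x" shows "path_reverse f \<in> loops_at X x"
proof -
  have "loop_homotopic X x (\<lambda>t. f (1 - t)) (\<lambda>t. f (1 - t))"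
    by (rule loop_homotopic_reparametrize[OF assms])
      (use assms in \<open>auto intro!: continuous_intros simp: loops_at_def\<close>)
  then show ?thesis unfolding path_reverse_def by (rule loop_homotopic_imp_loops_at(1))
qed

lemma const_loops_at: "x \<in> topspace X \<Longrightarrow> (\<lambda>_. x) \<in> loops_at X x"
  by (simp add: loops_at_def pathin_def)

lemma mult_fundamental_group:
  assumes "f \<in> loops_at X x" "g \<in> loops_at X x"
  shows "loop_class X x f \<otimes>\<^bsub>fundamental_group X x\<^esub> loop_class X x g = loop_class X x (path_concat f g)"
proof -
  have *: "loop_class X x (path_concat f' g') = loop_class X x (path_concat f g)"
    if "f' \<in> loop_class X x f" "g' \<in> loop_class X x g" for f' g'
    by (rule loop_class_eqI[OF loop_homotopic_concat, symmetric])
      (use that in \<open>simp_all only: loop_class_def mem_Collect_eq\<close>)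
  \<comment> \<open>Classes of loops are nonempty, so a union of one constant value over
    representatives is that value and not the empty set.\<close>
  have "f \<in> loop_class X x f" "g \<in> loop_class X x g"
    using assms unfolding loop_class_def mem_Collect_eq loops_at_iff by simp_all
  then have "(\<Union>f'\<in>loop_class X x f. \<Union>g'\<in>loop_class X x g. loop_class X x (path_concat f g)) =
      loop_class X x (path_concat f g)"
    by blast
  moreover have "(\<Union>f'\<in>loop_class X x f. \<Union>g'\<in>loop_class X x g. loop_class X x (path_concat f' g')) =
      (\<Union>f'\<in>loop_class X x f. \<Union>g'\<in>loop_class X x g. loop_class X x (path_concat f g))"
    by (intro SUP_cong refl *)
  ultimately show ?thesis unfolding fundamental_group_def monoid.simps by simp
qed

lemma loop_homotopic_assoc:
  assumes "f \<in> loops_at X x" "g \<in> loops_at X x" "h \<in> loops_at X x"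
  shows "loop_homotopic X x (path_concat (path_concat f g) h) (path_concat f (path_concat g h))"
proof -
  let ?F = "path_concat f (path_concat g h)"
  \<comment> \<open>The break points 1/4 and 1/2 of the left bracketing must go to 1/2 and 3/4. The
    slopes 2, 1, 1/2 decrease, so this piecewise linear map is the minimum of its pieces.\<close>
  let ?\<phi> = "\<lambda>t::real. min (2 * t) (min (t + 1/4) (t / 2 + 1/2))"
  have F: "?F \<in> loops_at X x" using assms by (intro path_concat_loops_at)
  have "loop_homotopic X x (\<lambda>t. ?F (?\<phi> t)) (\<lambda>t. ?F t)"
  proof (rule loop_homotopic_reparametrize[OF F])
    show "continuous_on {0..1} ?\<phi>" by (intro continuous_intros) simp_all
  qed (use F in \<open>auto simp: loops_at_def\<close>)
  moreover have "?F (?\<phi> t) = path_concat (path_concat f g) h t" for t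
  proof -
    consider "t \<le> 1/4" | "1/4 < t" "t \<le> 1/2" | "1/2 < t" by linarith
    then show ?thesis
      by cases (simp_all add: path_concat_def min_def algebra_simps)
  qed
  ultimately show ?thesis by simp
qed

lemma loop_homotopic_concat_const:
  assumes "f \<in> loops_at X x"
  shows "loop_homotopic X x (path_concat (\<lambda>_. x) f) f"
proof -
  have "loop_homotopic X x (\<lambda>t. f (max 0 (2 * t - 1))) (\<lambda>t. f t)"
  proof (rule loop_homotopic_reparametrize[OF assms])
    show "continuous_on {0..1} (\<lambda>t::real. max 0 (2 * t - 1))" by (intro continuous_intros)
  qed (use assms in \<open>auto simp: loops_at_def\<close>)
  moreover have "f (max 0 (2 * t - 1)) = path_concat (\<lambda>_. x) f t" for t
    using assms by (cases "t \<le> 1/2") (simp_all add: path_concat_def max_absorb1 max_absorb2 loops_at_def)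
  ultimately show ?thesis by simp
qed

lemma loop_homotopic_concat_reverse:
  assumes "f \<in> loops_at X x"
  shows "loop_homotopic X x (path_concat (path_reverse f) f) (\<lambda>_. x)"
proof -
  \<comment> \<open>The parameter is the absolute value of \<open>2 * t - 1\<close>. It starts and
    ends at 1, so it contracts to the constant 1 with fixed ends.\<close>
  have "loop_homotopic X x (\<lambda>t. f (max (1 - 2 * t) (2 * t - 1))) (\<lambda>t. f 1)"
  proof (rule loop_homotopic_reparametrize[OF assms])
    show "continuous_on {0..1} (\<lambda>t::real. max (1 - 2 * t) (2 * t - 1))" by (intro continuous_intros)
  qed (use assms in \<open>auto simp: loops_at_def\<close>)
  moreover have "f (max (1 - 2 * t) (2 * t - 1)) = path_concat (path_reverse f) f t" for t
    by (cases "t \<le> 1/2") (simp_all add: path_concat_def path_reverse_def max_absorb1 max_absorb2)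
  ultimately show ?thesis using assms by (simp add: loops_at_def)
qed

proposition group_fundamental_group:
  assumes "x \<in> topspace X"
  shows "group (fundamental_group X x)"
proof -
  let ?G = "fundamental_group X x"
  note mult = mult_fundamental_group
  have carrier: "A \<in> carrier ?G \<longleftrightarrow> (\<exists>f\<in>loops_at X x. A = loop_class X x f)" for A
    by (auto simp: fundamental_group_def)
  have one: "\<one>\<^bsub>?G\<^esub> = loop_class X x (\<lambda>_. x)" by (simp add: fundamental_group_def)
  have cl: "loop_class X x f \<in> carrier ?G" if "f \<in> loops_at X x" for f
    using that carrier by blast
  show ?thesis
  proof (rule groupI)
    show "\<one>\<^bsub>?G\<^esub> \<in> carrier ?G" unfolding one by (intro cl const_loops_at assms)
    fix A assume "A \<in> carrier ?G"
    then obtain f where f: "f \<in> loops_at X x" "A = loop_class X x f" by (auto simp: carrier)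
    show "\<one>\<^bsub>?G\<^esub> \<otimes>\<^bsub>?G\<^esub> A = A"
      using f by (simp add: one mult const_loops_at[OF assms] loop_class_eqI[OF loop_homotopic_concat_const])
    show "\<exists>B\<in>carrier ?G. B \<otimes>\<^bsub>?G\<^esub> A = \<one>\<^bsub>?G\<^esub>"
      using f by (intro bexI[of _ "loop_class X x (path_reverse f)"])
        (simp_all add: one mult cl path_reverse_loops_at loop_class_eqI[OF loop_homotopic_concat_reverse])
    fix B assume "B \<in> carrier ?G"
    then obtain g where g: "g \<in> loops_at X x" "B = loop_class X x g" by (auto simp: carrier)
    show "A \<otimes>\<^bsub>?G\<^esub> B \<in> carrier ?G"
      using f g by (simp add: mult cl path_concat_loops_at)
    fix C assume "C \<in> carrier ?G"
    then obtain h where h: "h \<in> loops_at X x" "C = loop_class X x h" by (auto simp: carrier)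
    show "A \<otimes>\<^bsub>?G\<^esub> B \<otimes>\<^bsub>?G\<^esub> C = A \<otimes>\<^bsub>?G\<^esub> (B \<otimes>\<^bsub>?G\<^esub> C)"
      using f g h by (simp add: mult path_concat_loops_at loop_class_eqI[OF loop_homotopic_assoc])
  qed
qed

subsection \<open>Scalar matrices\<close>

text \<open>Scalar multiples of a matrix are written \<open>mat c ** A\<close> throughout, so that
  identities between matrices can be checked on vectors.\<close>

lemma mat_mult_vector [simp]: "mat c *v (x :: 'a::comm_ring_1^'n) = c *s x"
  by (simp add: vec_eq_iff matrix_vector_mult_def mat_def if_distrib [where f = "\<lambda>z. z * _"] cong: if_cong)

lemma mat_commute: "mat c ** (A :: 'a::field^'n^'n) = A ** mat c"
  by (simp add: matrix_eq flip: matrix_vector_mul_assoc) (simp add: vector_scalar_commute)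

lemma matrix_mult_add_rdistrib:
  fixes A B C :: "'a::comm_ring_1^'n^'n"
  shows "(A + B) ** C = A ** C + B ** C"
  by (simp add: matrix_eq matrix_vector_mult_add_rdistrib flip: matrix_vector_mul_assoc)

lemma trace_mat_mult: "trace (mat c ** (A :: 'a::comm_ring_1^'n^'n)) = c * trace A"
  by (simp add: trace_def matrix_matrix_mult_def mat_def if_distrib [where f = "\<lambda>z. z * _"]
      sum_distrib_left cong: if_cong)

lemma det_mat_mult: "det (mat c ** (A :: 'a::field^'n^'n)) = c ^ CARD('n) * det A"
proof -
  have "det (mat c :: 'a^'n^'n) = c ^ CARD('n)"
    by (subst det_diagonal) (simp_all add: mat_def)
  then show ?thesis by (simp add: det_mul)
qed

subsection \<open>Eigenvectors\<close>

text \<open>Horner's scheme for the vector \<open>p(M) w\<close>; the matrix \<open>p(M)\<close>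
  itself is never formed.\<close>

definition poly_act :: "'a::field^'n^'n \<Rightarrow> 'a poly \<Rightarrow> 'a^'n \<Rightarrow> 'a^'n" where
  "poly_act M p w = fold_coeffs (\<lambda>a v. a *s w + M *v v) p 0"

lemma poly_act_0 [simp]: "poly_act M 0 w = 0"
  by (simp add: poly_act_def)

lemma poly_act_pCons [simp]: "poly_act M (pCons a p) w = a *s w + M *v poly_act M p w"
  by (cases "p = 0 \<and> a = 0") (auto simp: poly_act_def)

lemma poly_act_add: "poly_act M (p + q) w = poly_act M p w + poly_act M q w"
proof (induction p q rule: poly_induct2)
  case (pCons a p b q)
  then show ?case by (simp add: vec.scale_left_distrib matrix_vector_right_distrib)
qed simp

lemma poly_act_smult: "poly_act M (Polynomial.smult c p) w = c *s poly_act M p w"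
  by (induction p) (simp_all add: vec.scale_right_distrib vector_scalar_commute)

lemma poly_act_sum: "poly_act M (\<Sum>i\<in>I. f i) w = (\<Sum>i\<in>I. poly_act M (f i) w)"
  by (induction I rule: infinite_finite_induct) (simp_all add: poly_act_add)

lemma poly_act_subspace:
  assumes "vec.subspace W" "\<And>v. v \<in> W \<Longrightarrow> M *v v \<in> W" "w \<in> W"
  shows "poly_act M p w \<in> W"
  by (induction p) (use assms in \<open>auto intro: vec.subspace_add vec.subspace_scale vec.subspace_0\<close>)

text \<open>The vectors \<open>M^i w\<close>, for all \<open>i\<close>, live in a finite-dimensional
  space; the coefficients of a linear relation among them are those of \<open>p\<close>.\<close>

lemma poly_act_annihilator:
  fixes M :: "'a::field^'n^'n"
  obtains p where "p \<noteq> 0" "poly_act M p w = 0"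
proof -
  let ?f = "\<lambda>i. poly_act M (Polynomial.monom 1 i) w"
  show thesis
  \<comment> \<open>Linear dependence is a property of sets, so a repetition in the sequence is
    treated apart: it gives a difference of two monomials.\<close>
  proof (cases "inj ?f")
    case False
    then obtain i j where "i \<noteq> j" "?f i = ?f j" by (auto simp: inj_on_def)
    then have "Polynomial.monom 1 i + Polynomial.smult (-1) (Polynomial.monom 1 j) \<noteq> (0 :: 'a poly)"
      by (metis add.inverse_inverse eq_neg_iff_add_eq_0 monom_eq_iff' smult_minus_left smult_1_left zero_neq_one)
    moreover have "poly_act M (Polynomial.monom 1 i + Polynomial.smult (-1) (Polynomial.monom 1 j)) w = 0"
      using \<open>?f i = ?f j\<close> by (simp only: poly_act_add poly_act_smult) simp
    ultimately show thesis by (rule that)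
  next
    case True
    then have "infinite (range ?f)" by (simp add: finite_image_iff)
    then have "vec.dependent (range ?f)" using vec.finiteI_independent by blast
    then obtain S u v where S: "finite S" "S \<subseteq> range ?f" "(\<Sum>v\<in>S. u v *s v) = 0" "v \<in> S" "u v \<noteq> 0"
      unfolding vec.dependent_explicit by blast
    let ?J = "?f -` S"
    have J: "finite ?J" "?f ` ?J = S" using S(1,2) True by (auto intro: finite_vimageI)
    define p where "p = (\<Sum>i\<in>?J. Polynomial.smult (u (?f i)) (Polynomial.monom 1 i))"
    have "poly_act M p w = (\<Sum>i\<in>?J. u (?f i) *s ?f i)"
      by (simp only: p_def poly_act_sum poly_act_smult)
    also have "\<dots> = (\<Sum>v\<in>S. u v *s v)"
      using J(2) sum.reindex[of ?f ?J "\<lambda>v. u v *s v"] True by (simp add: inj_on_def)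
    finally have "poly_act M p w = 0" using S(3) by simp
    moreover obtain j where j: "v = ?f j" using S by blast
    have "Polynomial.coeff p j = (\<Sum>i\<in>?J. if i = j then u (?f i) else 0)"
      unfolding p_def coeff_sum by (intro sum.cong) simp_all
    then have "Polynomial.coeff p j = u v" using J(1) S(4) j by simp
    then have "p \<noteq> 0" using S(5) by auto
    ultimately show thesis using that by blast
  qed
qed

text \<open>Roots of an annihilating polynomial of \<open>w\<close> are peeled off: with
  \<open>p = (X - c) q\<close>, either \<open>q(M) w = 0\<close> and the degree drops, or
  \<open>q(M) w\<close> is an eigenvector, and it lies in \<open>W\<close> by invariance. No basis
  of \<open>W\<close> and no restriction of \<open>M\<close> is involved.\<close>

lemma invariant_subspace_eigenvector:
  fixes M :: "complex^'n^'n"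
  assumes W: "vec.subspace W" "\<And>v. v \<in> W \<Longrightarrow> M *v v \<in> W" and w: "w \<in> W" "w \<noteq> 0"
  obtains c v where "v \<in> W" "v \<noteq> 0" "M *v v = c *s v"
proof -
  obtain p where "p \<noteq> 0" "poly_act M p w = 0" by (rule poly_act_annihilator)
  then have "\<exists>c v. v \<in> W \<and> v \<noteq> 0 \<and> M *v v = c *s v"
  proof (induction "degree p" arbitrary: p rule: less_induct)
    case less
    show ?case
    proof (cases "degree p = 0")
      case True
      then obtain a where "p = [:a:]" by (rule degree_eq_zeroE)
      then show ?thesis using less.prems w(2) by simp
    next
      case False
      then obtain c where "poly p c = 0"
        using fundamental_theorem_of_algebra[of p] by (auto simp: constant_degree)
      then obtain q where q: "p = [:-c, 1:] * q" by (auto simp: poly_eq_0_iff_dvd)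
      then have "q \<noteq> 0" using less.prems by auto
      have "degree q < degree p" using \<open>q \<noteq> 0\<close> by (simp add: q degree_mult_eq del: mult_pCons_left)
      have *: "poly_act M p w = (-c) *s poly_act M q w + M *v poly_act M q w"
      proof -
        have "p = Polynomial.smult (-c) q + pCons 0 q" by (simp add: q)
        then show ?thesis by (simp only: poly_act_add poly_act_smult) simp
      qed
      show ?thesis
      proof (cases "poly_act M q w = 0")
        case True
        then show ?thesis using less.hyps[OF \<open>degree q < degree p\<close> \<open>q \<noteq> 0\<close>] by blast
      next
        case False
        moreover have "M *v poly_act M q w = c *s poly_act M q w"
          using * less.prems by (simp add: add_eq_0_iff)
        ultimately show ?thesis using poly_act_subspace[OF W w(1)] by blast
      qed
    qed
  qed
  then show thesis using that by blast
qed

text \<open>Applying \<open>M h - e a h\<close> to a relation kills the term of \<open>a\<close> and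
  keeps that of \<open>j\<close> whenever \<open>h\<close> separates \<open>a\<close> from
  \<open>j\<close>. The choice of \<open>h\<close> may depend on the pair, as weights require; a
  single matrix is the case \<open>H = {()}\<close>.\<close>

lemma simultaneous_eigenvectors_independent:
  fixes M :: "'h \<Rightarrow> 'a::field^'n^'n"
  assumes "finite I" "\<And>i. i \<in> I \<Longrightarrow> v i \<noteq> 0"
    and "\<And>i h. i \<in> I \<Longrightarrow> h \<in> H \<Longrightarrow> M h *v v i = e i h *s v i"
    and "\<And>i j. i \<in> I \<Longrightarrow> j \<in> I \<Longrightarrow> i \<noteq> j \<Longrightarrow> \<exists>h\<in>H. e i h \<noteq> e j h"
    and "(\<Sum>i\<in>I. c i *s v i) = 0" "i \<in> I"
  shows "c i = 0"
  using assms
proof (induction I arbitrary: c i rule: finite_induct)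
  case (insert a F)
  have F0: "c j = 0" if j: "j \<in> F" for j
  proof -
    have "a \<noteq> j" using insert.hyps(2) j by auto
    then obtain h where h: "h \<in> H" "e a h \<noteq> e j h" using insert.prems(3)[of a j] j by auto
    have "(\<Sum>i\<in>F. (c i * (e i h - e a h)) *s v i) = (\<Sum>i\<in>insert a F. (c i * (e i h - e a h)) *s v i)"
      using insert.hyps by simp
    also have "\<dots> = (\<Sum>i\<in>insert a F. M h *v (c i *s v i) - e a h *s (c i *s v i))"
      using insert.prems(2)[OF _ h(1)]
      by (intro sum.cong) (simp_all add: vector_scalar_commute vec.scale_left_diff_distrib algebra_simps)
    also have "\<dots> = M h *v (\<Sum>i\<in>insert a F. c i *s v i) - e a h *s (\<Sum>i\<in>insert a F. c i *s v i)"
      by (simp only: sum_subtractf vec.scale_sum_right vec.linear_sum[OF matrix_vector_mul_linear_gen])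
    finally have "(\<Sum>i\<in>F. (c i * (e i h - e a h)) *s v i) = 0" using insert.prems(4) by simp
    then have "c j * (e j h - e a h) = 0"
      by (intro insert.IH) (use insert.prems j in auto)
    then show ?thesis using h(2) by simp
  qed
  then have "c a *s v a = 0" using insert.prems(4) insert.hyps by simp
  then have "c a = 0" using insert.prems(1)[of a] by simp
  then show ?case using F0 insert.prems(5) by auto
qed simp

lemma simultaneous_eigenvectors_basis:
  fixes M :: "'h \<Rightarrow> 'a::field^'n^'n"
  assumes "finite I" "\<And>i. i \<in> I \<Longrightarrow> v i \<noteq> 0"
    and "\<And>i h. i \<in> I \<Longrightarrow> h \<in> H \<Longrightarrow> M h *v v i = e i h *s v i"
    and "\<And>i j. i \<in> I \<Longrightarrow> j \<in> I \<Longrightarrow> i \<noteq> j \<Longrightarrow> \<exists>h\<in>H. e i h \<noteq> e j h"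
  shows "inj_on v I" "vec.independent (v ` I)"
proof -
  show inj: "inj_on v I"
  proof (rule inj_onI, rule ccontr)
    fix i j assume ij: "i \<in> I" "j \<in> I" "v i = v j" "i \<noteq> j"
    then obtain h where "h \<in> H" "e i h \<noteq> e j h" using assms(4) by blast
    moreover have "e i h *s v i = e j h *s v i" using assms(3) ij \<open>h \<in> H\<close> by metis
    ultimately show False using assms(2) ij(1) by (simp add: vec.scale_cancel_right)
  qed
  show "vec.independent (v ` I)"
  proof (rule vec.independent_if_scalars_zero)
    fix u x assume u: "(\<Sum>x\<in>v ` I. u x *s x) = 0" "x \<in> v ` I"
    then obtain i where i: "i \<in> I" "x = v i" by blast
    have "(\<Sum>i\<in>I. u (v i) *s v i) = 0" using u(1) by (simp add: sum.reindex[OF inj])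
    from simultaneous_eigenvectors_independent[OF assms this i(1)] show "u x = 0" using i(2) by simp
  qed (use assms(1) in simp)
qed

text \<open>Extend \<open>w\<close> to a basis of \<open>W\<close>: the remaining basis vectors
  already span the image.\<close>

lemma dim_matrix_image_less:
  fixes M :: "'a::field^'n^'n"
  assumes W: "vec.subspace W" and w: "w \<in> W" "w \<noteq> 0" "M *v w = 0"
  shows "vec.dim ((*v) M ` W) < vec.dim W"
proof -
  obtain B where B: "{w} \<subseteq> B" "B \<subseteq> W" "vec.independent B" "W \<subseteq> vec.span B"
    using vec.maximal_independent_subset_extend[of "{w}" W] w by (auto simp: vec.dependent_single)
  have fin: "finite B" using B(3) vec.finiteI_independent by blast
  have card: "card B = vec.dim W" using B by (simp add: vec.dim_unique)
  have "(*v) M ` B \<subseteq> insert 0 ((*v) M ` (B - {w}))" using w(3) by auto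
  then have "vec.span ((*v) M ` B) \<subseteq> vec.span ((*v) M ` (B - {w}))"
    by (metis vec.span_insert_0 vec.span_mono)
  moreover have "(*v) M ` W \<subseteq> vec.span ((*v) M ` B)"
    using B(4) vec.linear_span_image[OF matrix_vector_mul_linear_gen, of M B] by blast
  ultimately have "vec.dim ((*v) M ` W) \<le> card ((*v) M ` (B - {w}))"
    using fin by (intro vec.dim_le_card) auto
  also have "\<dots> \<le> card (B - {w})" using fin by (intro card_image_le) auto
  also have "\<dots> < card B" using B(1) fin by (simp add: card_Diff1_less del: card_Diff_insert card_Diff_singleton)
  finally show ?thesis by (simp add: card)
qed

subsection \<open>Burnside's theorem\<close>

text \<open>Multiplying by the rank-one matrix with range spanned by \<open>y\<close> and row vector
  \<open>f\<close> turns a trace into the functional \<open>f\<close> evaluated at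
  \<open>N *v y\<close>.\<close>

lemma trace_outer_product:
  fixes N :: "'a::comm_ring_1^'n^'n"
  shows "trace ((\<chi> i j. y $ i * f $ j) ** N) = (\<Sum>j\<in>UNIV. f $ j * (N *v y) $ j)"
proof -
  have "trace ((\<chi> i j. y $ i * f $ j) ** N) = (\<Sum>i\<in>UNIV. \<Sum>j\<in>UNIV. f $ j * (N $ j $ i * y $ i))"
    by (simp add: trace_def matrix_matrix_mult_def mult_ac)
  also have "\<dots> = (\<Sum>j\<in>UNIV. \<Sum>i\<in>UNIV. f $ j * (N $ j $ i * y $ i))"
    by (rule sum.swap)
  finally show ?thesis
    by (simp add: matrix_vector_mult_def sum_distrib_left)
qed

locale irreducible_matrix_algebra =
  fixes \<A> :: "(complex^'n^'n) set"
  assumes add_closed: "X \<in> \<A> \<Longrightarrow> Y \<in> \<A> \<Longrightarrow> X + Y \<in> \<A>"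
    and scale_closed: "X \<in> \<A> \<Longrightarrow> mat c ** X \<in> \<A>"
    and mult_closed: "X \<in> \<A> \<Longrightarrow> Y \<in> \<A> \<Longrightarrow> X ** Y \<in> \<A>"
    and one_closed: "mat 1 \<in> \<A>"
    and irreducible: "vec.subspace W \<Longrightarrow> (\<And>X w. X \<in> \<A> \<Longrightarrow> w \<in> W \<Longrightarrow> X *v w \<in> W) \<Longrightarrow> W = {0} \<or> W = UNIV"
begin

text \<open>The vectors \<open>S *v y\<close> form an invariant subspace, which contains
  \<open>y\<close> itself.\<close>

lemma transitive:
  assumes "y \<noteq> 0" obtains S where "S \<in> \<A>" "S *v y = x"
proof -
  let ?W = "(\<lambda>S. S *v y) ` \<A>"
  have "vec.subspace ?W"
    unfolding vec.subspace_def
  proof (intro conjI ballI allI)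
    show "0 \<in> ?W" using scale_closed[OF one_closed, of 0] by (force simp: image_iff)
    show "a + b \<in> ?W" if "a \<in> ?W" "b \<in> ?W" for a b
      using that add_closed by (force simp: image_iff matrix_vector_mult_add_rdistrib)
    show "c *s a \<in> ?W" if a: "a \<in> ?W" for a c
    proof -
      obtain S where "S \<in> \<A>" "a = S *v y" using a by blast
      then show ?thesis
        using scale_closed[of S c] by (intro image_eqI[of _ _ "mat c ** S"]) (simp_all flip: matrix_vector_mul_assoc)
    qed
  qed
  moreover have "X *v w \<in> ?W" if "X \<in> \<A>" "w \<in> ?W" for X w
    using that mult_closed by (auto simp: matrix_vector_mul_assoc)
  ultimately have "?W = {0} \<or> ?W = UNIV" by (rule irreducible)
  moreover have "y \<in> ?W" using one_closed by (force simp: image_iff)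
  ultimately have "x \<in> ?W" using assms by blast
  then show thesis using that by blast
qed

text \<open>A nonzero element of minimal rank has rank one: for \<open>S \<in> \<A>\<close>, subtracting from \<open>T S T\<close> a multiple
  of \<open>T\<close> given by an eigenvalue of \<open>T S\<close> on the range of \<open>T\<close> lowers the rank, so
  \<open>T S T\<close> is a multiple of \<open>T\<close>.\<close>

lemma rank_one_element:
  obtains T y x0 where "T \<in> \<A>" "y \<noteq> 0" "T *v x0 = y" "\<And>x. \<exists>c. T *v x = c *s y"
proof -
  let ?r = "\<lambda>T::complex^'n^'n. vec.dim (range ((*v) T))"
  have "mat 1 \<noteq> (0 :: complex^'n^'n)"
    by (simp add: vec_eq_iff mat_def)
  then obtain T where T: "T \<in> \<A>" "T \<noteq> 0" and min: "\<And>S. S \<in> \<A> \<Longrightarrow> S \<noteq> 0 \<Longrightarrow> ?r T \<le> ?r S"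
    using ex_has_least_nat[of "\<lambda>T. T \<in> \<A> \<and> T \<noteq> 0" "mat 1" ?r] one_closed by auto
  let ?R = "range ((*v) T)"
  have R: "vec.subspace ?R"
    using vec.linear_subspace_image[OF matrix_vector_mul_linear_gen vec.subspace_UNIV] .
  obtain x0 where x0: "T *v x0 \<noteq> 0" using T(2) by (metis matrix_eq matrix_vector_mult_0)
  have multiple: "\<exists>c. T ** S ** T = mat c ** T" if S: "S \<in> \<A>" for S
  proof -
    obtain c w where w: "w \<in> ?R" "w \<noteq> 0" "(T ** S) *v w = c *s w"
      by (rule invariant_subspace_eigenvector[OF R, of "T ** S" "T *v x0"])
        (use x0 in \<open>auto simp flip: matrix_vector_mul_assoc\<close>)
    define L where "L = T ** S + mat (-c)"
    have "L *v w = 0" using w(3) by (simp add: L_def matrix_vector_mult_add_rdistrib)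
    then have "vec.dim ((*v) L ` ?R) < ?r T" by (rule dim_matrix_image_less[OF R w(1,2)])
    moreover have "(*v) L ` ?R = range ((*v) (L ** T))"
      by (auto simp: image_image simp flip: matrix_vector_mul_assoc)
    moreover have "L ** T \<in> \<A>"
      using S T(1) scale_closed[OF one_closed, of "-c"] unfolding L_def
      by (auto intro!: mult_closed add_closed)
    ultimately have "L ** T = 0" using min[of "L ** T"] by fastforce
    then have "T ** S ** T = mat c ** T"
      by (simp add: L_def matrix_eq matrix_vector_mult_add_rdistrib flip: matrix_vector_mul_assoc) 
    then show ?thesis by blast
  qed
  \<comment> \<open>Write \<open>x = S T x0\<close>; then \<open>T x = T S T x0\<close> is a
    multiple of \<open>T x0\<close>.\<close>
  have "\<exists>c. T *v x = c *s (T *v x0)" for x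
  proof -
    obtain S where S: "S \<in> \<A>" "S *v (T *v x0) = x" using transitive[OF x0] .
    obtain c where "T ** S ** T = mat c ** T" using multiple[OF S(1)] by blast
    then have "(T ** S ** T) *v x0 = c *s (T *v x0)" by (simp flip: matrix_vector_mul_assoc)
    then show ?thesis using S(2) by (auto simp flip: matrix_vector_mul_assoc)
  qed
  then show thesis using that T(1) x0 by blast
qed

text \<open>Since \<open>X\<close> ranges over all matrices, the orthogonal complement of
  \<open>\<A>\<close> under the trace form is zero: this is Burnside's theorem in dual form. Testing
  \<open>X\<close> against products \<open>S T S'\<close> with \<open>T\<close> of rank one turns
  the vanishing traces into the vanishing of a functional on vectors.\<close>

lemma trace_form_nondegenerate:
  assumes X: "\<And>Y. Y \<in> \<A> \<Longrightarrow> trace (X ** Y) = 0"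
  shows "X = 0"
proof -
  obtain T y x0 where T: "T \<in> \<A>" "y \<noteq> 0" "T *v x0 = y" "\<And>x. \<exists>c. T *v x = c *s y"
    by (rule rank_one_element) blast
  then obtain c where c: "\<And>x. T *v x = c x *s y" by metis
  define f where "f = (\<chi> j. c (axis j 1))"
  define \<phi> where "\<phi> = (\<lambda>v. \<Sum>j\<in>UNIV. f $ j * v $ j)"
  have T_eq: "T = (\<chi> i j. y $ i * f $ j)"
  proof -
    have "T $ i $ j = y $ i * f $ j" for i j
      proof -
      have "T $ i $ j = (T *v axis j 1) $ i"
        by (simp add: matrix_vector_mult_def axis_def if_distrib [where f = "\<lambda>z. _ * z"] cong: if_cong)
      then show ?thesis by (simp add: c f_def)
    qed
    then show ?thesis by (simp add: vec_eq_iff)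
  qed
  have T_apply: "T *v v = \<phi> v *s y" for v
    by (simp add: T_eq \<phi>_def vec_eq_iff matrix_vector_mult_def sum_distrib_left mult_ac)
  have \<phi>0: "\<phi> (S' *v (X *v (S *v y))) = 0" if "S \<in> \<A>" "S' \<in> \<A>" for S S'
  proof -
    have "0 = trace (X ** (S ** T ** S'))" using X T(1) that mult_closed by simp
    also have "\<dots> = trace (T ** (S' ** X ** S))"
      using trace_mul_sym[of "X ** S" "T ** S'"] by (simp add: matrix_mul_assoc)
    also have "\<dots> = \<phi> (S' *v (X *v (S *v y)))"
      by (simp add: T_eq trace_outer_product \<phi>_def flip: matrix_vector_mul_assoc)
    finally show ?thesis by simp
  qed
  \<comment> \<open>The largest invariant subspace on which \<open>\<phi>\<close> vanishes. It
    misses \<open>x0\<close>, so it is zero, and it contains every \<open>X S y\<close>.\<close>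
  let ?W = "{v. \<forall>S\<in>\<A>. \<phi> (S *v v) = 0}"
  have "\<phi> (a + b) = \<phi> a + \<phi> b" "\<phi> (c *s a) = c * \<phi> a" "\<phi> 0 = 0" for a b c
    by (simp_all add: \<phi>_def distrib_left sum.distrib sum_distrib_left mult_ac)
  then have "vec.subspace ?W"
    by (simp add: vec.subspace_def matrix_vector_right_distrib vector_scalar_commute)
  moreover have "A *v w \<in> ?W" if "A \<in> \<A>" "w \<in> ?W" for A w
    using that mult_closed by (auto simp: matrix_vector_mul_assoc)
  ultimately have "?W = {0} \<or> ?W = UNIV" by (rule irreducible)
  moreover have "\<phi> x0 \<noteq> 0" using T(2,3) T_apply[of x0] by auto
  then have "x0 \<notin> ?W" using one_closed by force
  ultimately have "?W = {0}" by auto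
  moreover have "X *v (S *v y) \<in> ?W" if "S \<in> \<A>" for S using \<phi>0 that by simp
  ultimately have "X *v (S *v y) = 0" if "S \<in> \<A>" for S using that by blast
  then have "X *v x = 0" for x using transitive[OF T(2), of x] by metis
  then show ?thesis by (simp add: matrix_eq)
qed

end

subsection \<open>Irreducible representations with the same character\<close>

lemma group_SL: "group (SL :: (complex^'n^'n) monoid)"
proof (rule groupI)
  fix A :: "complex^'n^'n" assume A: "A \<in> carrier SL"
  then have "invertible A" by (simp add: SL_def invertible_det_nz)
  then obtain B where B: "B ** A = mat 1" by (auto simp: invertible_def)
  then have "det B = 1" using A det_mul[of B A] by (simp add: SL_def)
  then show "\<exists>B\<in>carrier SL. B \<otimes>\<^bsub>SL\<^esub> A = \<one>\<^bsub>SL\<^esub>" using B by (auto simp: SL_def)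
qed (simp_all add: SL_def det_mul matrix_mul_assoc)

lemma rep_mult:
  assumes "\<alpha> \<in> rep_variety G" "g \<in> carrier G" "h \<in> carrier G"
  shows "\<alpha> (g \<otimes>\<^bsub>G\<^esub> h) = \<alpha> g ** \<alpha> h"
  using hom_mult[of \<alpha> G SL g h] assms by (simp add: rep_variety_def SL_def)

lemma rep_one:
  assumes "group G" "\<alpha> \<in> rep_variety G"
  shows "\<alpha> \<one>\<^bsub>G\<^esub> = mat 1"
  using hom_one[OF _ assms(1) group_SL, of \<alpha>] assms(2) by (simp add: rep_variety_def SL_def)

text \<open>The graph of \<open>\<alpha> g \<mapsto> \<beta> g\<close> extended linearly to the spans; for irreducible representations with
  the same character, nondegeneracy of the trace form makes this relation a bijection.\<close>

inductive_set paired_span ::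
    "('g, 'm) monoid_scheme \<Rightarrow> ('g \<Rightarrow> complex^'n^'n) \<Rightarrow> ('g \<Rightarrow> complex^'n^'n) \<Rightarrow>
      ((complex^'n^'n) \<times> (complex^'n^'n)) set"
  for G \<alpha> \<beta> where
  base: "g \<in> carrier G \<Longrightarrow> (\<alpha> g, \<beta> g) \<in> paired_span G \<alpha> \<beta>"
| add: "(X, X') \<in> paired_span G \<alpha> \<beta> \<Longrightarrow> (Y, Y') \<in> paired_span G \<alpha> \<beta> \<Longrightarrow>
    (X + Y, X' + Y') \<in> paired_span G \<alpha> \<beta>"
| scale: "(X, X') \<in> paired_span G \<alpha> \<beta> \<Longrightarrow> (mat c ** X, mat c ** X') \<in> paired_span G \<alpha> \<beta>"

lemma paired_span_swap: "(X, X') \<in> paired_span G \<alpha> \<beta> \<Longrightarrow> (X', X) \<in> paired_span G \<beta> \<alpha>"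
  by (induction rule: paired_span.induct) (simp_all add: paired_span.intros)

text \<open>Nested inductions, one per factor, reduce to generators, where the product of two pairs
  is again a generator because \<open>\<alpha>\<close> and \<open>\<beta>\<close> are both
  multiplicative.\<close>

lemma paired_span_mult:
  fixes \<alpha> \<beta> :: "'g \<Rightarrow> complex^'n^'n"
  assumes G: "group G" and reps: "\<alpha> \<in> rep_variety G" "\<beta> \<in> rep_variety G"
    and X: "(X, X') \<in> paired_span G \<alpha> \<beta>" and Y: "(Y, Y') \<in> paired_span G \<alpha> \<beta>"
  shows "(X ** Y, X' ** Y') \<in> paired_span G \<alpha> \<beta>"
  using X
proof (induction rule: paired_span.induct)
  case (base g)
  show ?case
    using Y
  proof (induction rule: paired_span.induct)
    case (base h)
    interpret group G by (rule G)
    have "g \<otimes>\<^bsub>G\<^esub> h \<in> carrier G" using base \<open>g \<in> carrier G\<close> by simp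
    from paired_span.base[OF this, of \<alpha> \<beta>] show ?case
      using base \<open>g \<in> carrier G\<close> reps by (simp add: rep_mult)
  next
    case (add Y Y' Z Z')
    then show ?case by (simp add: matrix_add_ldistrib paired_span.add)
  next
    case (scale Y Y' c)
    have comm: "A ** (mat c ** B) = mat c ** (A ** B)" for A B :: "complex^'n^'n"
      by (simp only: matrix_mul_assoc mat_commute[of c A])
    show ?case unfolding comm by (rule paired_span.scale) (rule scale.IH)
  qed
next
  case (add X X' Z Z')
  then show ?case by (simp add: matrix_mult_add_rdistrib paired_span.add)
next
  case (scale X X' c)
  show ?case unfolding matrix_mul_assoc[symmetric] by (rule paired_span.scale) (rule scale.IH)
qed

lemma irreducible_matrix_algebra_paired_span:
  fixes \<alpha> \<beta> :: "'g \<Rightarrow> complex^'n^'n"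
  assumes G: "group G" and \<alpha>: "irreducible_rep G \<alpha>" and \<beta>: "\<beta> \<in> rep_variety G"
  shows "irreducible_matrix_algebra (fst ` paired_span G \<alpha> \<beta>)"
proof
  have rep: "\<alpha> \<in> rep_variety G" using \<alpha> by (simp add: irreducible_rep_def)
  interpret group G by (rule G)
  show "mat 1 \<in> fst ` paired_span G \<alpha> \<beta>"
    using paired_span.base[OF one_closed, of \<alpha> \<beta>] rep_one[OF G rep] by force
  fix X Y c assume X: "X \<in> fst ` paired_span G \<alpha> \<beta>"
  then obtain X' where X': "(X, X') \<in> paired_span G \<alpha> \<beta>" by force
  show "mat c ** X \<in> fst ` paired_span G \<alpha> \<beta>" using paired_span.scale[OF X'] by force
  assume Y: "Y \<in> fst ` paired_span G \<alpha> \<beta>"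
  then obtain Y' where Y': "(Y, Y') \<in> paired_span G \<alpha> \<beta>" by force
  show "X + Y \<in> fst ` paired_span G \<alpha> \<beta>" using paired_span.add[OF X' Y'] by force
  show "X ** Y \<in> fst ` paired_span G \<alpha> \<beta>" using paired_span_mult[OF G rep \<beta> X' Y'] by force
next
  fix W assume W: "vec.subspace W" "\<And>X w. X \<in> fst ` paired_span G \<alpha> \<beta> \<Longrightarrow> w \<in> W \<Longrightarrow> X *v w \<in> W"
  have "\<alpha> g *v w \<in> W" if "g \<in> carrier G" "w \<in> W" for g w
    using W(2)[of "\<alpha> g" w] paired_span.base[of g G \<alpha> \<beta>] that by force
  then show "W = {0} \<or> W = UNIV" using \<alpha> W(1) by (simp add: irreducible_rep_def)
qed

lemma paired_span_trace:
  assumes "group G" "\<alpha> \<in> rep_variety G" "\<beta> \<in> rep_variety G"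
    and tr: "\<And>g. g \<in> carrier G \<Longrightarrow> trace (\<alpha> g) = trace (\<beta> g)"
    and "(X, X') \<in> paired_span G \<alpha> \<beta>"
  shows "trace X = trace X'"
  using assms(5) by (induction rule: paired_span.induct) (simp_all add: tr trace_add trace_mat_mult)

text \<open>Paired matrices have equal traces, also after multiplication by another pair. So if one
  component is zero, the other is orthogonal to its whole algebra.\<close>

lemma paired_span_zero_iff:
  fixes \<alpha> \<beta> :: "'g \<Rightarrow> complex^'n^'n"
  assumes G: "group G" and irr: "irreducible_rep G \<alpha>" "irreducible_rep G \<beta>"
    and tr: "\<And>g. g \<in> carrier G \<Longrightarrow> trace (\<alpha> g) = trace (\<beta> g)"
    and X: "(X, X') \<in> paired_span G \<alpha> \<beta>"
  shows "X = 0 \<longleftrightarrow> X' = 0"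
proof -
  have reps: "\<alpha> \<in> rep_variety G" "\<beta> \<in> rep_variety G" using irr by (simp_all add: irreducible_rep_def)
  have *: "trace (X ** Y) = trace (X' ** Y')" if "(Y, Y') \<in> paired_span G \<alpha> \<beta>" for Y Y'
    using paired_span_trace[OF G reps tr paired_span_mult[OF G reps X that]] .
  interpret \<alpha>: irreducible_matrix_algebra "fst ` paired_span G \<alpha> \<beta>"
    by (rule irreducible_matrix_algebra_paired_span[OF G irr(1) reps(2)])
  interpret \<beta>: irreducible_matrix_algebra "fst ` paired_span G \<beta> \<alpha>"
    by (rule irreducible_matrix_algebra_paired_span[OF G irr(2) reps(1)])
  show ?thesis
  proof
    assume "X = 0"
    show "X' = 0"
    proof (rule \<beta>.trace_form_nondegenerate)
      fix Y' assume "Y' \<in> fst ` paired_span G \<beta> \<alpha>"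
      then obtain Y where "(Y, Y') \<in> paired_span G \<alpha> \<beta>" using paired_span_swap by force
      from *[OF this] \<open>X = 0\<close> show "trace (X' ** Y') = 0" by (simp add: trace_def matrix_matrix_mult_def)
    qed
  next
    assume "X' = 0"
    show "X = 0"
    proof (rule \<alpha>.trace_form_nondegenerate)
      fix Y assume "Y \<in> fst ` paired_span G \<alpha> \<beta>"
      then obtain Y' where "(Y, Y') \<in> paired_span G \<alpha> \<beta>" by force
      from *[OF this] \<open>X' = 0\<close> show "trace (X ** Y) = 0" by (simp add: trace_def matrix_matrix_mult_def)
    qed
  qed
qed

text \<open>With \<open>T\<close> of rank one and range spanned by \<open>y\<close>, the intertwiner sends \<open>S y\<close> to \<open>S' T' u\<close>,
  where primes denote transport from the span of \<open>\<alpha>\<close> to that of \<open>\<beta>\<close>.\<close>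

proposition same_character_intertwiner:
  fixes \<alpha> \<beta> :: "'g \<Rightarrow> complex^'n^'n"
  assumes G: "group G" and irr: "irreducible_rep G \<alpha>" "irreducible_rep G \<beta>"
    and tr: "\<And>g. g \<in> carrier G \<Longrightarrow> trace (\<alpha> g) = trace (\<beta> g)"
  obtains A where "A \<noteq> 0" "\<And>g. g \<in> carrier G \<Longrightarrow> A ** \<alpha> g = \<beta> g ** A"
proof -
  have reps: "\<alpha> \<in> rep_variety G" "\<beta> \<in> rep_variety G" using irr by (simp_all add: irreducible_rep_def)
  let ?P = "paired_span G \<alpha> \<beta>"
  have zero_iff: "X = 0 \<longleftrightarrow> X' = 0" if "(X, X') \<in> ?P" for X X'
    by (rule paired_span_zero_iff[OF G irr _ that]) (rule tr)
  note mult = paired_span_mult[OF G reps]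
  interpret irreducible_matrix_algebra "fst ` ?P"
    by (rule irreducible_matrix_algebra_paired_span[OF G irr(1) reps(2)])
  obtain T y x0 where T: "T \<in> fst ` ?P" "y \<noteq> 0" "T *v x0 = y" "\<And>x. \<exists>c. T *v x = c *s y"
    by (rule rank_one_element) blast
  then obtain T' where T': "(T, T') \<in> ?P" by force
  have "T \<noteq> 0" using T(2,3) by auto
  then have "T' \<noteq> 0" using zero_iff[OF T'] by simp
  then obtain u where u: "T' *v u \<noteq> 0" by (metis matrix_eq matrix_vector_mult_0)
  \<comment> \<open>For each \<open>x\<close>, \<open>p\<close> will choose a pair whose first
    component sends \<open>y\<close> to \<open>x\<close>.\<close>
  have "\<exists>p. p \<in> ?P \<and> fst p *v y = x" for x
    using transitive[OF T(2), of x] by (metis imageE)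
  then obtain p where p: "\<And>x. p x \<in> ?P" "\<And>x. fst (p x) *v y = x" by metis
  define f where "f = (\<lambda>x. snd (p x) *v (T' *v u))"
  \<comment> \<open>Independence of the choice: the difference of two candidates kills
    \<open>y\<close>, hence kills \<open>T\<close>, whose range is spanned by \<open>y\<close>. Its
    partner therefore kills \<open>T'\<close>.\<close>
  have f_eq: "f (S *v y) = S' *v (T' *v u)" if S: "(S, S') \<in> ?P" for S S'
  proof -
    define D where "D = S + mat (-1) ** fst (p (S *v y))"
    define D' where "D' = S' + mat (-1) ** snd (p (S *v y))"
    have D: "(D, D') \<in> ?P"
      unfolding D_def D'_def using S p(1) by (intro paired_span.add paired_span.scale) simp_all
    have Dy: "D *v y = 0"
      by (simp add: D_def matrix_vector_mult_add_rdistrib p(2) flip: matrix_vector_mul_assoc)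
    have "(D ** T) *v x = 0" for x
      using T(4)[of x] Dy by (auto simp: vector_scalar_commute simp flip: matrix_vector_mul_assoc)
    then have "D ** T = 0" by (simp add: matrix_eq)
    then have "D' ** T' = 0" using zero_iff[OF mult[OF D T']] by simp
    then have "D' *v (T' *v u) = 0" by (simp add: matrix_vector_mul_assoc)
    then show ?thesis
      by (simp add: D'_def f_def matrix_vector_mult_add_rdistrib flip: matrix_vector_mul_assoc)
  qed
  \<comment> \<open>The sum of the pairs chosen for \<open>a\<close> and \<open>b\<close> sends
    \<open>y\<close> to \<open>a + b\<close>, so it may be used to compute \<open>f\<close>.\<close>
  have "f (a + b) = f a + f b" for a b
    using f_eq[OF paired_span.add, of "fst (p a)" "snd (p a)" "fst (p b)" "snd (p b)"] p
    by (simp add: matrix_vector_mult_add_rdistrib f_def)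
  moreover have "f (c *s a) = c *s f a" for c a
    using f_eq[OF paired_span.scale, of "fst (p a)" "snd (p a)" c] p
    by (simp add: f_def flip: matrix_vector_mul_assoc)
  ultimately have "Vector_Spaces.linear (*s) (*s) f" by unfold_locales
  then have A: "matrix f *v x = f x" for x by (rule matrix_works)
  show thesis
  proof
    \<comment> \<open>The pair of identity matrices shows \<open>f y = T' u\<close>, which is
      nonzero by the choice of \<open>u\<close>.\<close>
    have "f (mat 1 *v y) = mat 1 *v (T' *v u)"
    proof -
      interpret group G by (rule G)
      show ?thesis
        using f_eq[OF paired_span.base[OF one_closed]] rep_one[OF G reps(1)] rep_one[OF G reps(2)] by simp
    qed
    then show "matrix f \<noteq> 0" using A[of y] u by auto
    show "matrix f ** \<alpha> g = \<beta> g ** matrix f" if g: "g \<in> carrier G" for g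
    proof -
      have "f (\<alpha> g *v x) = \<beta> g *v f x" for x
        using f_eq[OF mult[OF paired_span.base[OF g]], of "fst (p x)" "snd (p x)"] p
        by (simp add: f_def flip: matrix_vector_mul_assoc)
      then show ?thesis by (simp add: matrix_eq A flip: matrix_vector_mul_assoc)
    qed
  qed
qed

text \<open>Schur's lemma: the kernel of \<open>A\<close> is invariant under
  \<open>\<alpha>\<close>.\<close>

lemma intertwiner_injective:
  assumes "irreducible_rep G \<alpha>" "A \<noteq> 0" "\<And>g. g \<in> carrier G \<Longrightarrow> A ** \<alpha> g = \<beta> g ** A"
    and "A *v x = 0"
  shows "x = 0"
proof -
  let ?W = "{x. A *v x = 0}"
  have "vec.subspace ?W"
    by (simp add: vec.subspace_def matrix_vector_right_distrib vector_scalar_commute)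
  moreover have "\<alpha> g *v w \<in> ?W" if "g \<in> carrier G" "w \<in> ?W" for g w
    using that assms(3)[of g] by (simp add: matrix_vector_mul_assoc) (simp flip: matrix_vector_mul_assoc)
  ultimately have "?W = {0} \<or> ?W = UNIV" using assms(1) unfolding irreducible_rep_def by blast
  moreover have "?W \<noteq> UNIV" using assms(2) by (auto simp: matrix_eq)
  ultimately show ?thesis using assms(4) by blast
qed

subsection \<open>Representations of an extension of the integers\<close>

lemma span_image_sum:
  fixes v :: "'i \<Rightarrow> 'a::field^'n"
  assumes "finite I" "inj_on v I" "x \<in> vec.span (v ` I)"
  obtains c where "x = (\<Sum>i\<in>I. c i *s v i)"
proof -
  obtain u where "x = (\<Sum>b\<in>v ` I. u b *s b)"
    using assms(3) vec.span_finite[of "v ` I"] assms(1) by auto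
  then have "x = (\<Sum>i\<in>I. u (v i) *s v i)" by (simp add: sum.reindex[OF assms(2)])
  then show thesis by (rule that)
qed

lemma matrix_eq_on_span:
  fixes M N :: "'a::field^'n^'n"
  assumes "vec.span B = UNIV" "\<And>b. b \<in> B \<Longrightarrow> M *v b = N *v b"
  shows "M = N"
proof -
  have "vec.subspace {x. M *v x = N *v x}"
    by (simp add: vec.subspace_def matrix_vector_right_distrib vector_scalar_commute)
  then have "vec.span B \<subseteq> {x. M *v x = N *v x}" using assms(2) by (intro vec.span_minimal) auto
  then show ?thesis using assms(1) by (auto simp: matrix_eq)
qed

lemma span_eq_UNIV_of_card:
  fixes B :: "('a::field^'n) set"
  assumes "vec.independent B" "card B = CARD('n)"
  shows "vec.span B = UNIV"
  using vec.card_ge_dim_independent[of B UNIV] assms vec_dim_card[where 'a='a and 'n='n] by (auto simp del: vec.dim_UNIV)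

text \<open>In a nonzero invariant subspace of least dimension, each eigenspace of an
  \<open>M h\<close> is again invariant by commutativity, hence is everything. Minimality replaces
  an iteration over \<open>H\<close>, which may be infinite.\<close>

lemma commuting_matrices_common_eigenvector:
  fixes M :: "'h \<Rightarrow> complex^'n^'n"
  assumes comm: "\<And>g h. g \<in> H \<Longrightarrow> h \<in> H \<Longrightarrow> M g ** M h = M h ** M g"
  obtains v \<kappa> where "v \<noteq> 0" "\<And>h. h \<in> H \<Longrightarrow> M h *v v = \<kappa> h *s v"
proof -
  let ?P = "\<lambda>W. vec.subspace W \<and> (\<exists>w\<in>W. w \<noteq> 0) \<and> (\<forall>h\<in>H. \<forall>w\<in>W. M h *v w \<in> W)"
  have "?P (UNIV :: (complex^'n) set)"
    using vec.subspace_UNIV by (auto intro: exI[of _ "axis undefined 1"] simp: axis_eq_0_iff)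
  then obtain W where W: "?P W" and min: "\<And>V. ?P V \<Longrightarrow> vec.dim W \<le> vec.dim V"
    using ex_has_least_nat[of ?P UNIV vec.dim] by blast
  then obtain w0 where w0: "w0 \<in> W" "w0 \<noteq> 0" by blast
  have "\<exists>c. M h *v w0 = c *s w0" if h: "h \<in> H" for h
  proof -
    obtain c w where w: "w \<in> W" "w \<noteq> 0" "M h *v w = c *s w"
      by (rule invariant_subspace_eigenvector[of W "M h" w0]) (use W w0 h in auto)
    let ?V = "{x \<in> W. M h *v x = c *s x}"
    have sub: "vec.subspace ?V"
      using W by (auto simp: vec.subspace_def matrix_vector_right_distrib vector_scalar_commute
          vec.scale_right_distrib vec.scale_left_commute)
    have "M g *v x \<in> ?V" if "g \<in> H" "x \<in> ?V" for g x
    proof -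
      have "M h *v (M g *v x) = M g *v (M h *v x)"
        using comm[OF h that(1)] by (simp add: matrix_vector_mul_assoc)
      then show ?thesis using that W by (simp add: vector_scalar_commute)
    qed
    then have "?P ?V" using sub w by blast
    then have "?V = W" using min[of ?V] W sub by (intro vec.subspace_dim_equal) auto
    then show ?thesis using w0 by auto
  qed
  then show thesis using that w0(2) by metis
qed

lemma root_of_unity_powi_eq_iff:
  assumes "i \<in> {0..<int n}" "j \<in> {0..<int n}"
  shows "cis (2 * pi / real n) powi i = cis (2 * pi / real n) powi j \<longleftrightarrow> i = j"
proof -
  have *: "cis (2 * pi / real n) powi int k = cis (2 * pi * real k / real n)" for k
    by (simp add: cis_power_int mult_ac del: power_int_of_nat)
  obtain a b where ab: "i = int a" "j = int b" "a < n" "b < n"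
    using assms zero_le_imp_eq_int by (metis atLeastLessThan_iff of_nat_less_iff)
  have inj: "inj_on (\<lambda>k. cis (2 * pi * real k / real n)) {..<n}"
    using Complex.bij_betw_roots_unity[of n] ab(3) by (simp add: bij_betw_def)
  show ?thesis
    unfolding ab(1,2) * using inj_on_eq_iff[OF inj, of a b] ab(3,4) by simp
qed

lemma root_of_unity_powi_self: "n > 0 \<Longrightarrow> cis (2 * pi / real n) powi int n = 1"
  by (simp add: cis_power_int del: power_int_of_nat)

text \<open>\<open>m\<close> plays the meridian; any element with \<open>\<epsilon> m = 1\<close>
  splits \<open>\<epsilon>\<close>, so that every element is a power of \<open>m\<close> times an
  element of the kernel.\<close>

locale integer_extension_rep = group G for G (structure) +
  fixes \<alpha> :: "'a \<Rightarrow> complex^'n^'n" and \<epsilon> :: "'a \<Rightarrow> int" and m :: 'a and \<omega> :: complex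
  assumes rep: "\<alpha> \<in> rep_variety G"
    and hom: "\<epsilon> \<in> hom G integer_group"
    and m [simp]: "m \<in> carrier G" "\<epsilon> m = 1"
    and \<omega>_def: "\<omega> = cis (2 * pi / real CARD('n))"
begin

abbreviation "K \<equiv> kernel G integer_group \<epsilon>"

lemma K_iff: "h \<in> K \<longleftrightarrow> h \<in> carrier G \<and> \<epsilon> h = 0"
  by (simp add: kernel_def integer_group_def)

lemma eps_mult [simp]: "g \<in> carrier G \<Longrightarrow> h \<in> carrier G \<Longrightarrow> \<epsilon> (g \<otimes> h) = \<epsilon> g + \<epsilon> h"
  using hom by (simp add: hom_def integer_group_def)

lemma eps_pow [simp]: "\<epsilon> (m [^] (i::int)) = i"
proof -
  interpret h: group_hom G integer_group \<epsilon>
    by (simp add: group_hom_def group_hom_axioms_def hom is_group)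
  show ?thesis by (simp add: h.hom_int_pow)
qed

lemma rep_apply [simp]:
  "g \<in> carrier G \<Longrightarrow> h \<in> carrier G \<Longrightarrow> \<alpha> (g \<otimes> h) *v x = \<alpha> g *v (\<alpha> h *v x)"
  by (simp add: rep_mult[OF rep] matrix_vector_mul_assoc)

lemma rep_apply_one [simp]: "\<alpha> \<one> *v x = x"
  by (simp add: rep_one[OF group_axioms rep])

lemma rep_apply_eq_0_iff [simp]: "g \<in> carrier G \<Longrightarrow> \<alpha> g *v x = 0 \<longleftrightarrow> x = 0"
  using rep_apply[of "inv g" g x] by auto

lemma decompose:
  assumes "g \<in> carrier G" obtains h where "h \<in> K" "g = m [^] \<epsilon> g \<otimes> h"
proof
  show "m [^] (- \<epsilon> g) \<otimes> g \<in> K" using assms by (simp add: K_iff)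
  show "g = m [^] \<epsilon> g \<otimes> (m [^] (- \<epsilon> g) \<otimes> g)"
    using assms by (simp add: int_pow_neg flip: m_assoc)
qed

text \<open>The sign makes \<open>h \<otimes> m [^] i = m [^] i \<otimes> conj_pow i h\<close>, so
  translating a weight vector by \<open>m [^] i\<close> composes its weight with
  \<open>conj_pow i\<close>.\<close>

definition conj_pow :: "int \<Rightarrow> 'a \<Rightarrow> 'a" where
  "conj_pow i h = m [^] (- i) \<otimes> h \<otimes> m [^] i"

lemma conj_pow_K: "h \<in> K \<Longrightarrow> conj_pow i h \<in> K"
  by (simp add: K_iff conj_pow_def)

lemma conj_pow_add:
  assumes "h \<in> K" shows "conj_pow i (conj_pow j h) = conj_pow (i + j) h"
proof -
  have "conj_pow (i + j) h = (m [^] (-i) \<otimes> m [^] (-j)) \<otimes> h \<otimes> (m [^] j \<otimes> m [^] i)"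
    by (simp add: conj_pow_def add.commute flip: int_pow_mult)
  then show ?thesis using assms by (simp add: conj_pow_def K_iff m_assoc)
qed

lemma conj_pow_0: "h \<in> K \<Longrightarrow> conj_pow 0 h = h"
  by (simp add: conj_pow_def K_iff)

lemma rep_shift:
  "h \<in> K \<Longrightarrow> \<alpha> h *v (\<alpha> (m [^] i) *v x) = \<alpha> (m [^] i) *v (\<alpha> (conj_pow i h) *v x)"
proof -
  assume h: "h \<in> K"
  have "h \<otimes> m [^] i = m [^] i \<otimes> conj_pow i h"
    using h by (simp add: conj_pow_def K_iff int_pow_neg flip: m_assoc)
  then have "\<alpha> (h \<otimes> m [^] i) *v x = \<alpha> (m [^] i \<otimes> conj_pow i h) *v x" by simp
  then show ?thesis using h conj_pow_K[OF h] by (simp add: K_iff)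
qed

text \<open>\<open>\<alpha> g\<close> multiplies eigenvalues of \<open>A\<close> by
  \<open>\<omega> powi \<epsilon> g\<close>. Elements of \<open>K\<close> therefore preserve the
  eigenspaces, which are lines once \<open>CARD('n)\<close> eigenvalues are known to be
  distinct.\<close>

lemma commute_of_intertwiner:
  assumes inj: "\<And>x. A *v x = 0 \<Longrightarrow> x = 0"
    and A: "\<And>g. g \<in> carrier G \<Longrightarrow> A ** \<alpha> g = mat (\<omega> powi \<epsilon> g) ** \<alpha> g ** A"
    and gh: "g \<in> K" "h \<in> K"
  shows "\<alpha> g ** \<alpha> h = \<alpha> h ** \<alpha> g"
proof -
  have A': "A *v (\<alpha> g *v x) = (\<omega> powi \<epsilon> g) *s (\<alpha> g *v (A *v x))" if "g \<in> carrier G" for g x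
    using A[OF that] by (metis mat_mult_vector matrix_vector_mul_assoc)
  obtain \<kappa> w where w: "w \<noteq> 0" "A *v w = \<kappa> *s w"
    by (rule invariant_subspace_eigenvector[of UNIV A "axis undefined 1"])
      (auto simp: axis_eq_0_iff vec.subspace_UNIV)
  \<comment> \<open>Needed to keep the eigenvalues \<open>\<omega> powi i * \<kappa>\<close>
    apart.\<close>
  have "\<kappa> \<noteq> 0" using w inj[of w] by auto
  define v where "v = (\<lambda>i::int. \<alpha> (m [^] i) *v w)"
  let ?I = "{0..<int CARD('n)}"
  have v: "A *v v i = (\<omega> powi i * \<kappa>) *s v i" for i
    by (simp add: v_def A' w(2) vector_scalar_commute)
  have sep: "\<omega> powi i * \<kappa> \<noteq> \<omega> powi j * \<kappa>" if "i \<in> ?I" "j \<in> ?I" "i \<noteq> j" for i j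
    using root_of_unity_powi_eq_iff[of i "CARD('n)" j] that \<open>\<kappa> \<noteq> 0\<close> by (simp add: \<omega>_def)
  have v0: "v i \<noteq> 0" for i using w(1) by (simp add: v_def)
  note eig = simultaneous_eigenvectors_basis[of ?I v "{()}" "\<lambda>_. A" "\<lambda>i _. \<omega> powi i * \<kappa>"]
  have basis: "inj_on v ?I" "vec.independent (v ` ?I)"
    using eig v sep v0 by auto
  have span: "vec.span (v ` ?I) = UNIV"
    by (intro span_eq_UNIV_of_card basis) (simp add: card_image[OF basis(1)])
  have diag: "\<exists>c. \<alpha> h *v v k = c *s v k" if h: "h \<in> K" and k: "k \<in> ?I" for h k
  proof -
    obtain c where c: "\<alpha> h *v v k = (\<Sum>i\<in>?I. c i *s v i)"
      using span_image_sum[OF _ basis(1), of "\<alpha> h *v v k"] span by auto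
    have "A *v (\<alpha> h *v v k) = (\<omega> powi k * \<kappa>) *s (\<alpha> h *v v k)"
      using h by (simp add: A' K_iff v vector_scalar_commute)
    \<comment> \<open>Both \<open>\<alpha> h *v v k\<close> and \<open>v k\<close> belong to the
      same eigenvalue of \<open>A\<close>; comparing coefficients leaves only the term of index
      \<open>k\<close>.\<close>
    then have "(\<Sum>i\<in>?I. (c i * (\<omega> powi i * \<kappa> - \<omega> powi k * \<kappa>)) *s v i) = 0"
      unfolding c by (simp add: vec.linear_sum[OF matrix_vector_mul_linear_gen] vector_scalar_commute v
          vec.scale_sum_right algebra_simps vec.scale_left_diff_distrib sum_subtractf)
    then have "c i * (\<omega> powi i * \<kappa> - \<omega> powi k * \<kappa>) = 0" if "i \<in> ?I" for i
      using simultaneous_eigenvectors_independent[of ?I v "{()}" "\<lambda>_. A" "\<lambda>i _. \<omega> powi i * \<kappa>"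
          "\<lambda>i. c i * (\<omega> powi i * \<kappa> - \<omega> powi k * \<kappa>)" i] v sep v0 that by auto
    then have "c i = 0" if "i \<in> ?I" "i \<noteq> k" for i using sep that k by fastforce
    then have "\<alpha> h *v v k = (\<Sum>i\<in>?I. if i = k then c k *s v k else 0)"
      unfolding c by (intro sum.cong) auto
    then show ?thesis using k by auto
  qed
  show ?thesis
  proof (rule matrix_eq_on_span[OF span])
    fix b assume "b \<in> v ` ?I"
    then obtain k where k: "k \<in> ?I" "b = v k" by blast
    obtain c d where "\<alpha> g *v v k = c *s v k" "\<alpha> h *v v k = d *s v k"
      using diag[OF gh(1) k(1)] diag[OF gh(2) k(1)] by blast
    then show "(\<alpha> g ** \<alpha> h) *v b = (\<alpha> h ** \<alpha> g) *v b"
      by (simp add: k(2) vector_scalar_commute mult.commute flip: matrix_vector_mul_assoc)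
  qed
qed

text \<open>Every \<open>g\<close> shifts the index of the translates by
  \<open>\<epsilon> g\<close>, up to a scalar. A diagonal \<open>A\<close> with eigenvalues
  \<open>\<omega> powi j\<close> on them hence conjugates \<open>\<alpha> g\<close> to
  \<open>\<omega> powi \<epsilon> g\<close> times itself, and conjugation preserves traces.\<close>

lemma trace_of_commuting_kernel:
  assumes irr: "irreducible_rep G \<alpha>"
    and comm: "\<And>g h. g \<in> K \<Longrightarrow> h \<in> K \<Longrightarrow> \<alpha> g ** \<alpha> h = \<alpha> h ** \<alpha> g"
    and g: "g \<in> carrier G"
  shows "\<omega> powi \<epsilon> g * trace (\<alpha> g) = trace (\<alpha> g)"
proof -
  obtain w \<kappa> where w: "w \<noteq> 0" "\<And>h. h \<in> K \<Longrightarrow> \<alpha> h *v w = \<kappa> h *s w"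
    using commuting_matrices_common_eigenvector[of K \<alpha>] comm by metis
  define wt where "wt = (\<lambda>i h. \<kappa> (conj_pow i h))"
  have shift_weight: "\<alpha> h *v (\<alpha> (m [^] i) *v x) = wt i h *s (\<alpha> (m [^] i) *v x)"
    if "\<forall>h\<in>K. \<alpha> h *v x = \<kappa> h *s x" "h \<in> K" for i h x
    using that by (simp add: rep_shift conj_pow_K wt_def vector_scalar_commute)
  define same where "same = (\<lambda>i j. \<forall>h\<in>K. wt i h = wt j h)"
  \<comment> \<open>Evaluating at \<open>conj_pow (-i) h\<close> lowers both indices by
    \<open>i\<close>, so coincidence of weights depends only on the difference.\<close>
  have same_diff: "same 0 (j - i)" if "same i j" for i j
    unfolding same_def
  proof
    fix h assume h: "h \<in> K"
    then have "wt i (conj_pow (-i) h) = wt j (conj_pow (-i) h)"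
      using that conj_pow_K[OF h] by (auto simp: same_def)
    then show "wt 0 h = wt (j - i) h" using h by (simp add: wt_def conj_pow_add)
  qed
  have same_ex: "\<exists>k>0. same 0 (int k)"
  proof (rule ccontr)
    assume no: "\<not> ?thesis"
    have less: "\<not> same i j" if "i < j" for i j
    proof
      assume "same i j"
      then have "same 0 (int (nat (j - i)))" using same_diff[of i j] that by simp
      moreover have "0 < nat (j - i)" using that by simp
      ultimately show False using no by blast
    qed
    have sep: "\<exists>h\<in>K. wt i h \<noteq> wt j h" if "i \<noteq> j" for i j
    proof -
      have "\<not> same i j \<or> \<not> same j i" using less that by (meson linorder_neqE)
      then show ?thesis unfolding same_def by metis
    qed
    \<comment> \<open>The closed interval has \<open>CARD('n) + 1\<close> indices, one too many for
      independent vectors.\<close>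
    let ?v = "\<lambda>i. \<alpha> (m [^] (i::int)) *v w" and ?I = "{0..int CARD('n)}"
    have "inj_on ?v ?I" "vec.independent (?v ` ?I)"
      using simultaneous_eigenvectors_basis[of ?I ?v K \<alpha> wt] sep shift_weight w by auto
    then have "CARD('n) + 1 \<le> vec.dim (UNIV :: (complex^'n) set)"
      using vec.independent_card_le_dim[of "?v ` ?I" UNIV] by (simp add: card_image)
    then show False by (simp add: vec_dim_card del: vec.dim_UNIV)
  qed
  define k where "k = (LEAST k. 0 < k \<and> same 0 (int k))"
  have k: "0 < k" "same 0 (int k)" and k_min: "\<And>i. 0 < i \<Longrightarrow> i < k \<Longrightarrow> \<not> same 0 (int i)"
    using LeastI_ex[of "\<lambda>k. 0 < k \<and> same 0 (int k)"] same_ex not_less_Least[of _ "\<lambda>k. 0 < k \<and> same 0 (int k)"]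
    unfolding k_def by auto
  \<comment> \<open>The weight space of \<open>\<kappa>\<close>. It is preserved by
    \<open>m [^] int k\<close> because the weights with indices 0 and \<open>k\<close> agree, so it
    contains an eigenvector of that power.\<close>
  define U where "U = {x. \<forall>h\<in>K. \<alpha> h *v x = \<kappa> h *s x}"
  have "w \<in> U" using w(2) by (simp add: U_def)
  have U_shift: "\<alpha> (m [^] int k) *v x \<in> U" if "x \<in> U" for x
    using that k(2) shift_weight[of x _ "int k"] by (simp add: U_def same_def wt_def conj_pow_0)
  have "vec.subspace U"
    by (auto simp: U_def vec.subspace_def matrix_vector_right_distrib vector_scalar_commute
        vec.scale_right_distrib vec.scale_left_commute)
  then obtain c x where x: "x \<in> U" "x \<noteq> 0" "\<alpha> (m [^] int k) *v x = c *s x"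
    using invariant_subspace_eigenvector[OF _ U_shift \<open>w \<in> U\<close> w(1)] by blast
  have "c \<noteq> 0" using x(2,3) rep_apply_eq_0_iff[of "m [^] int k" x] by (auto simp del: rep_apply_eq_0_iff)
  define v where "v = (\<lambda>i::int. \<alpha> (m [^] i) *v x)"
  let ?I = "{0..<int k}"
  have v0: "v i \<noteq> 0" for i using x(2) by (simp add: v_def)
  have v_shift: "\<alpha> (m [^] j) *v v i = v (j + i)" for i j by (simp add: v_def int_pow_mult)
  have v_weight: "\<alpha> h *v v i = wt i h *s v i" if "h \<in> K" for h i
    using shift_weight[of x h i] x(1) that by (simp add: v_def U_def)
  have v_step: "v (i + int k) = c *s v i" for i
    by (simp add: v_def int_pow_mult x(3) vector_scalar_commute)
  have v_period: "v (i + int k * q) = (c powi q) *s v i" for i q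
  proof (induction q rule: int_induct[where k = 0])
    case (step1 q)
    have "v (i + int k * (q + 1)) = v ((i + int k * q) + int k)" by (simp add: algebra_simps)
    also have "\<dots> = c *s ((c powi q) *s v i)" by (simp only: v_step step1)
    also have "\<dots> = (c powi (q + 1)) *s v i" using \<open>c \<noteq> 0\<close> by (simp add: power_int_add mult.commute)
    finally show ?case .
  next
    case (step2 q)
    have "c *s v (i + int k * (q - 1)) = v ((i + int k * (q - 1)) + int k)" by (simp only: v_step)
    also have "(i + int k * (q - 1)) + int k = i + int k * q" by (simp add: algebra_simps)
    also have "v (i + int k * q) = c *s ((c powi (q - 1)) *s v i)"
      using power_int_add[of c 1 "q - 1"] \<open>c \<noteq> 0\<close> by (simp add: step2)
    finally show ?case using \<open>c \<noteq> 0\<close> by (simp only: vec.scale_cancel_left) simp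
  qed simp
  \<comment> \<open>All translates are multiples of the first \<open>k\<close>, so their span is
    invariant under negative powers of \<open>m\<close> as well.\<close>
  have v_mod: "v j = (c powi (j div int k)) *s v (j mod int k)" for j
    using v_period[of "j mod int k" "j div int k"] by simp
  have sep_less: "\<not> same i j" if "i \<in> ?I" "j \<in> ?I" "i < j" for i j
    using k_min[of "nat (j - i)"] same_diff[of i j] that by auto
  have sep: "\<exists>h\<in>K. wt i h \<noteq> wt j h" if "i \<in> ?I" "j \<in> ?I" "i \<noteq> j" for i j
  proof -
    have "\<not> same i j \<or> \<not> same j i" using sep_less that by (meson linorder_neqE)
    then show ?thesis unfolding same_def by metis
  qed
  have basis: "inj_on v ?I" "vec.independent (v ` ?I)"
    using simultaneous_eigenvectors_basis[of ?I v K \<alpha> wt] sep v0 v_weight by auto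
  have rep_v: "\<exists>d. \<alpha> g *v v i = d *s v (\<epsilon> g + i)" if g: "g \<in> carrier G" for g i
  proof -
    obtain h where h: "h \<in> K" "g = m [^] \<epsilon> g \<otimes> h" using decompose[OF g] .
    have "\<alpha> (m [^] \<epsilon> g \<otimes> h) *v v i = wt i h *s v (\<epsilon> g + i)"
      using h(1) by (simp add: K_iff v_weight v_shift vector_scalar_commute)
    then show ?thesis using h(2) by metis
  qed
  let ?W = "vec.span (v ` ?I)"
  have v_W: "v j \<in> ?W" for j
    using k(1) by (subst v_mod) (intro vec.span_scale vec.span_base imageI, simp)
  have "\<alpha> g *v y \<in> ?W" if g: "g \<in> carrier G" "y \<in> ?W" for g y
  proof -
    have "vec.subspace {y. \<alpha> g *v y \<in> ?W}"
      by (auto simp: vec.subspace_def matrix_vector_right_distrib vector_scalar_commute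
          intro: vec.span_add vec.span_scale vec.span_zero)
    moreover have "v ` ?I \<subseteq> {y. \<alpha> g *v y \<in> ?W}"
    proof clarify
      fix i
      obtain d where "\<alpha> g *v v i = d *s v (\<epsilon> g + i)" using rep_v[OF g(1)] by blast
      then show "\<alpha> g *v v i \<in> ?W" by (simp add: vec.span_scale v_W)
    qed
    ultimately have "?W \<subseteq> {y. \<alpha> g *v y \<in> ?W}" by (rule vec.span_minimal[rotated])
    then show ?thesis using g(2) by blast
  qed
  then have "?W = {0} \<or> ?W = UNIV"
    using irr vec.subspace_span unfolding irreducible_rep_def by blast
  then have span: "?W = UNIV" using v_W[of 0] v0[of 0] by auto
  have "k = CARD('n)"
    using vec.dim_span_eq_card_independent[OF basis(2)] card_image[OF basis(1)] vec_dim_card[where 'a=complex and 'n='n]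
    by (simp add: span del: vec.dim_UNIV)
  \<comment> \<open>The map is prescribed on the basis with indices below \<open>k\<close>. The
    formula extends to all \<open>j\<close> because both sides scale alike when \<open>j\<close>
    changes by \<open>k\<close>, thanks to \<open>z powi int k = 1\<close>.\<close>
  have diagonal: "\<exists>A. \<forall>j. A *v v j = (z powi j) *s v j" if z: "z powi int k = 1" for z
  proof -
    have "z \<noteq> 0" using z k(1) by (auto simp: zero_power)
    obtain F where F: "Vector_Spaces.linear (*s) (*s) F"
        "\<forall>b\<in>v ` ?I. F b = (z powi the_inv_into ?I v b) *s b"
      using vec.linear_independent_extend[OF basis(2), of "\<lambda>b. (z powi the_inv_into ?I v b) *s b"] by blast
    have "matrix F *v v j = (z powi j) *s v j" for j
    proof -
      have r: "j mod int k \<in> ?I" using k(1) by simp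
      have "z powi (int k * (j div int k) + j mod int k) = z powi (int k * (j div int k)) * z powi (j mod int k)"
        using \<open>z \<noteq> 0\<close> by (intro power_int_add) simp
      moreover have "z powi (int k * (j div int k)) = 1" by (simp only: power_int_mult z power_int_1_left)
      ultimately have "z powi j = z powi (j mod int k)" by simp
      moreover have "matrix F *v v (j mod int k) = (z powi (j mod int k)) *s v (j mod int k)"
        using F(2) r by (simp add: matrix_works[OF F(1)] the_inv_into_f_f[OF basis(1) r])
      ultimately show ?thesis
        by (subst (1 2) v_mod[of j]) (simp only: vector_scalar_commute vec.scale_left_commute)
    qed
    then show ?thesis by blast
  qed
  have \<omega>k: "\<omega> powi int k = 1" and \<omega>0: "\<omega> \<noteq> 0"
    using root_of_unity_powi_self[of k] k(1) by (simp_all add: \<omega>_def \<open>k = CARD('n)\<close>)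
  obtain A where A: "\<And>j. A *v v j = (\<omega> powi j) *s v j" using diagonal[OF \<omega>k] by blast
  \<comment> \<open>The same construction with \<open>inverse \<omega>\<close> supplies the inverse
    of \<open>A\<close>.\<close>
  have "inverse \<omega> powi int k = 1" by (subst power_int_inverse) (simp only: \<omega>k inverse_1)
  then obtain B where B: "\<And>j. B *v v j = (inverse \<omega> powi j) *s v j" using diagonal by blast
  have AB: "A ** B = mat 1"
  proof (rule matrix_eq_on_span[OF span])
    fix b assume "b \<in> v ` ?I"
    then show "(A ** B) *v b = mat 1 *v b"
      using \<omega>0 by (auto simp: A B vector_scalar_commute power_int_inverse simp flip: matrix_vector_mul_assoc)
  qed
  have "A ** \<alpha> g = mat (\<omega> powi \<epsilon> g) ** (\<alpha> g ** A)"
  proof (rule matrix_eq_on_span[OF span])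
    fix b assume "b \<in> v ` ?I"
    then obtain i where i: "b = v i" by blast
    obtain d where "\<alpha> g *v v i = d *s v (\<epsilon> g + i)" using rep_v[OF g] by blast
    then show "(A ** \<alpha> g) *v b = (mat (\<omega> powi \<epsilon> g) ** (\<alpha> g ** A)) *v b"
      using \<omega>0 by (simp add: i A vector_scalar_commute power_int_add mult_ac flip: matrix_vector_mul_assoc)
  qed
  then have "\<omega> powi \<epsilon> g * trace (\<alpha> g ** A ** B) = trace (A ** \<alpha> g ** B)"
    by (simp add: trace_mat_mult flip: matrix_mul_assoc)
  also have "\<dots> = trace (\<alpha> g ** (B ** A))"
    using trace_mul_sym[of A "\<alpha> g ** B"] by (simp add: matrix_mul_assoc)
  also have "B ** A = mat 1" using AB by (simp add: matrix_left_right_inverse)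
  finally show ?thesis by (simp add: AB flip: matrix_mul_assoc)
qed

end

subsection \<open>Fixed characters and metabelian representations\<close>

text \<open>Invariance under the generator suffices: where the trace is nonzero,
  \<open>\<omega> powi \<epsilon> g\<close> is 1, and so are its powers.\<close>

lemma fixed_character_iff:
  fixes \<alpha> :: "'g \<Rightarrow> complex^'n^'n"
  assumes "\<alpha> \<in> rep_variety G"
  shows "fixed_character TYPE('n) G \<epsilon> (character G \<alpha>) \<longleftrightarrow>
    (\<forall>g\<in>carrier G. cis (2 * pi / real CARD('n)) powi \<epsilon> g * trace (\<alpha> g) = trace (\<alpha> g))"
proof -
  let ?\<omega> = "cis (2 * pi / real CARD('n))"
  have "char_action TYPE('n) G \<epsilon> j (character G \<alpha>) = character G \<alpha> \<longleftrightarrow>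
      (\<forall>g\<in>carrier G. ?\<omega> powi (j * \<epsilon> g) * trace (\<alpha> g) = trace (\<alpha> g))" for j
  proof -
    have "character G (rep_action \<epsilon> j \<alpha>) = character G \<alpha> \<longleftrightarrow>
        (\<forall>g\<in>carrier G. trace (rep_action \<epsilon> j \<alpha> g) = trace (\<alpha> g))"
      by (auto simp: character_def restrict_def fun_eq_iff)
    then show ?thesis by (simp only: char_action_character[OF assms] trace_rep_action)
  qed
  moreover have "character G \<alpha> \<in> char_variety TYPE('n) G" using assms by (auto simp: char_variety_def)
  ultimately have "fixed_character TYPE('n) G \<epsilon> (character G \<alpha>) \<longleftrightarrow>
      (\<forall>j\<in>{0..<int CARD('n)}. \<forall>g\<in>carrier G. ?\<omega> powi (j * \<epsilon> g) * trace (\<alpha> g) = trace (\<alpha> g))"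
    by (simp add: fixed_character_def invariants_def carrier_integer_mod_group)
  also have "\<dots> \<longleftrightarrow> (\<forall>g\<in>carrier G. ?\<omega> powi \<epsilon> g * trace (\<alpha> g) = trace (\<alpha> g))"
  proof (intro iffI ballI)
    fix g assume *: "\<forall>j\<in>{0..<int CARD('n)}. \<forall>g\<in>carrier G. ?\<omega> powi (j * \<epsilon> g) * trace (\<alpha> g) = trace (\<alpha> g)"
      and g: "g \<in> carrier G"
    show "?\<omega> powi \<epsilon> g * trace (\<alpha> g) = trace (\<alpha> g)"
    \<comment> \<open>In dimension 1 the only residue is 0, so the generator is not among the
      \<open>j\<close>; but then \<open>\<omega>\<close> is 1.\<close>
    proof (cases "CARD('n) = 1")
      case False
      moreover have "CARD('n) > 0" by simp
      ultimately have "1 \<in> {0..<int CARD('n)}" by (simp del: zero_less_card_finite)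
      then show ?thesis using * g by fastforce
    qed simp
  next
    fix j g assume *: "\<forall>g\<in>carrier G. ?\<omega> powi \<epsilon> g * trace (\<alpha> g) = trace (\<alpha> g)"
      and g: "g \<in> carrier G"
    then have "trace (\<alpha> g) = 0 \<or> ?\<omega> powi \<epsilon> g = 1" by force
    then show "?\<omega> powi (j * \<epsilon> g) * trace (\<alpha> g) = trace (\<alpha> g)"
      by (auto simp: mult.commute[of j] power_int_mult)
  qed
  finally show ?thesis .
qed

section \<open>Twisting a representation by roots of unity\<close>

lemma rep_action_eq:
  fixes \<alpha> :: "'g \<Rightarrow> complex^'n^'n"
  shows "rep_action \<epsilon> j \<alpha> g = mat (cis (2 * pi / real CARD('n)) powi (j * \<epsilon> g)) ** \<alpha> g"
  by (simp add: rep_action_def vec_eq_iff matrix_matrix_mult_def mat_def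
      if_distrib [where f = "\<lambda>z. z * _"] cong: if_cong)

text \<open>The determinant is multiplied by the \<open>CARD('n)\<close>-th power of a root of unity
  of that order, which is 1, and nonzero scalars do not change which subspaces are
  invariant.\<close>

lemma irreducible_rep_action:
  fixes \<alpha> :: "'g \<Rightarrow> complex^'n^'n"
  assumes irr: "irreducible_rep G \<alpha>" and hom: "\<epsilon> \<in> hom G integer_group"
  shows "irreducible_rep G (rep_action \<epsilon> j \<alpha>)"
proof -
  let ?\<omega> = "cis (2 * pi / real CARD('n))"
  let ?c = "\<lambda>g. ?\<omega> powi (j * \<epsilon> g)"
  have rep: "\<alpha> \<in> rep_variety G" using irr by (simp add: irreducible_rep_def)
  have c0: "?c g \<noteq> 0" for g by simp
  have "rep_action \<epsilon> j \<alpha> \<in> rep_variety G"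
    unfolding rep_variety_def
  proof (rule homI)
    fix g assume g: "g \<in> carrier G"
    have "?c g ^ CARD('n) = ?c g powi int CARD('n)" by (rule power_int_of_nat[symmetric])
    also have "\<dots> = ?\<omega> powi (int CARD('n) * (j * \<epsilon> g))"
      by (simp only: power_int_mult[symmetric] mult.commute[of "j * \<epsilon> g"])
    also have "\<dots> = 1" by (simp only: power_int_mult root_of_unity_powi_self zero_less_card_finite power_int_1_left)
    finally show "rep_action \<epsilon> j \<alpha> g \<in> carrier SL"
      using rep g by (simp add: rep_action_eq SL_def det_mat_mult rep_variety_def hom_def Pi_iff)
    fix h assume h: "h \<in> carrier G"
    have "\<epsilon> (g \<otimes>\<^bsub>G\<^esub> h) = \<epsilon> g + \<epsilon> h" using hom_mult[OF hom g h] by (simp add: integer_group_def)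
    then have "rep_action \<epsilon> j \<alpha> (g \<otimes>\<^bsub>G\<^esub> h) *v x = rep_action \<epsilon> j \<alpha> g *v (rep_action \<epsilon> j \<alpha> h *v x)" for x
      by (simp add: rep_action_eq rep_mult[OF rep g h] distrib_left power_int_add vector_scalar_commute
          flip: matrix_vector_mul_assoc)
    then show "rep_action \<epsilon> j \<alpha> (g \<otimes>\<^bsub>G\<^esub> h) = rep_action \<epsilon> j \<alpha> g \<otimes>\<^bsub>SL\<^esub> rep_action \<epsilon> j \<alpha> h"
      by (simp add: SL_def matrix_eq matrix_vector_mul_assoc)
  qed
  moreover have "W = {0} \<or> W = UNIV"
    if W: "vec.subspace W" "\<forall>g\<in>carrier G. \<forall>w\<in>W. rep_action \<epsilon> j \<alpha> g *v w \<in> W" for W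
  proof -
    have "\<alpha> g *v w \<in> W" if "g \<in> carrier G" "w \<in> W" for g w
    proof -
      have "?c g *s (\<alpha> g *v w) \<in> W"
        using W(2) that by (simp add: rep_action_eq flip: matrix_vector_mul_assoc)
      then have "inverse (?c g) *s (?c g *s (\<alpha> g *v w)) \<in> W" using W(1) by (rule vec.subspace_scale[rotated])
      then show ?thesis using c0[of g] by simp
    qed
    then show ?thesis using irr W(1) by (simp add: irreducible_rep_def)
  qed
  ultimately show ?thesis by (simp add: irreducible_rep_def)
qed

text \<open>Factoring through the quotient means killing the second derived subgroup. This subgroup
  is generated by commutators of elements of the first, and killing a commutator means that the
  images of its two entries commute.\<close>

lemma metabelian_rep_iff_commute:
  fixes \<alpha> :: "'g \<Rightarrow> complex^'n^'n"
  assumes G: "group G" and rep: "\<alpha> \<in> rep_variety G"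
  shows "metabelian_rep G \<alpha> \<longleftrightarrow>
    (\<forall>g\<in>derived G (carrier G). \<forall>h\<in>derived G (carrier G). \<alpha> g ** \<alpha> h = \<alpha> h ** \<alpha> g)"
proof
  interpret group_hom G "SL :: (complex^'n^'n) monoid" \<alpha>
    using rep by (simp add: group_hom_def group_hom_axioms_def G group_SL rep_variety_def)
  let ?D = "derived G (carrier G)"
  have D: "?D \<subseteq> carrier G" by (rule G.derived_in_carrier) simp
  have D2: "(derived G ^^ 2) (carrier G) = derived G ?D" by (simp add: numeral_2_eq_2)
  {
    assume "metabelian_rep G \<alpha>"
    then obtain \<beta> where \<beta>: "\<And>g. g \<in> carrier G \<Longrightarrow> \<alpha> g = \<beta> (derived G ?D #>\<^bsub>G\<^esub> g)"
      by (auto simp: metabelian_rep_def D2 Let_def)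
    show "\<forall>g\<in>?D. \<forall>h\<in>?D. \<alpha> g ** \<alpha> h = \<alpha> h ** \<alpha> g"
    proof (intro ballI)
      fix g h assume gh: "g \<in> ?D" "h \<in> ?D"
      then have c: "g \<in> carrier G" "h \<in> carrier G" using D by auto
      let ?c = "g \<otimes>\<^bsub>G\<^esub> h \<otimes>\<^bsub>G\<^esub> inv\<^bsub>G\<^esub> g \<otimes>\<^bsub>G\<^esub> inv\<^bsub>G\<^esub> h"
      have "?c \<in> derived G ?D"
        unfolding derived_def[of G ?D] using gh by (intro generate.incl) blast
      moreover have "subgroup (derived G ?D) G" using D by (rule G.derived_is_subgroup)
      ultimately have "derived G ?D #>\<^bsub>G\<^esub> ?c = derived G ?D #>\<^bsub>G\<^esub> \<one>\<^bsub>G\<^esub>"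
        using c by (simp add: G.coset_join2 G.coset_mult_one subgroup.subset)
      then have "\<alpha> ?c = \<alpha> \<one>\<^bsub>G\<^esub>" using \<beta>[of ?c] \<beta>[of "\<one>\<^bsub>G\<^esub>"] c by simp
      then have c1: "\<alpha> ?c = mat 1" using rep_one[OF G rep] by simp
      have "?c = g \<otimes>\<^bsub>G\<^esub> h \<otimes>\<^bsub>G\<^esub> inv\<^bsub>G\<^esub> (h \<otimes>\<^bsub>G\<^esub> g)"
        using c by (simp add: G.inv_mult_group G.m_assoc)
      then have "g \<otimes>\<^bsub>G\<^esub> h = ?c \<otimes>\<^bsub>G\<^esub> (h \<otimes>\<^bsub>G\<^esub> g)"
        using c G.inv_solve_right[of ?c "g \<otimes>\<^bsub>G\<^esub> h" "h \<otimes>\<^bsub>G\<^esub> g"] by simp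
      moreover have "\<alpha> (?c \<otimes>\<^bsub>G\<^esub> (h \<otimes>\<^bsub>G\<^esub> g)) = \<alpha> ?c ** \<alpha> (h \<otimes>\<^bsub>G\<^esub> g)"
        using c by (intro rep_mult[OF rep]) simp_all
      ultimately have "\<alpha> (g \<otimes>\<^bsub>G\<^esub> h) = \<alpha> (h \<otimes>\<^bsub>G\<^esub> g)" by (simp only: c1 matrix_mul_lid)
      then show "\<alpha> g ** \<alpha> h = \<alpha> h ** \<alpha> g" using rep_mult[OF rep] c by metis
    qed
  next
    assume comm: "\<forall>g\<in>?D. \<forall>h\<in>?D. \<alpha> g ** \<alpha> h = \<alpha> h ** \<alpha> g"
    have "derived_set G ?D \<subseteq> kernel G SL \<alpha>"
    proof clarify
      fix g h assume gh: "g \<in> ?D" "h \<in> ?D"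
      then have c: "g \<in> carrier G" "h \<in> carrier G" using D by auto
      have "g \<otimes>\<^bsub>G\<^esub> h \<otimes>\<^bsub>G\<^esub> inv\<^bsub>G\<^esub> g \<otimes>\<^bsub>G\<^esub> inv\<^bsub>G\<^esub> h =
          g \<otimes>\<^bsub>G\<^esub> h \<otimes>\<^bsub>G\<^esub> (inv\<^bsub>G\<^esub> g \<otimes>\<^bsub>G\<^esub> inv\<^bsub>G\<^esub> h)"
        using c by (simp add: G.m_assoc)
      then have "\<alpha> (g \<otimes>\<^bsub>G\<^esub> h \<otimes>\<^bsub>G\<^esub> inv\<^bsub>G\<^esub> g \<otimes>\<^bsub>G\<^esub> inv\<^bsub>G\<^esub> h) =
          \<alpha> (g \<otimes>\<^bsub>G\<^esub> h) ** \<alpha> (inv\<^bsub>G\<^esub> g \<otimes>\<^bsub>G\<^esub> inv\<^bsub>G\<^esub> h)"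
        using c rep_mult[OF rep, of "g \<otimes>\<^bsub>G\<^esub> h" "inv\<^bsub>G\<^esub> g \<otimes>\<^bsub>G\<^esub> inv\<^bsub>G\<^esub> h"] by simp
      also have "\<alpha> (g \<otimes>\<^bsub>G\<^esub> h) = \<alpha> (h \<otimes>\<^bsub>G\<^esub> g)"
        using comm gh c rep_mult[OF rep] by metis
      also have "\<alpha> (h \<otimes>\<^bsub>G\<^esub> g) ** \<alpha> (inv\<^bsub>G\<^esub> g \<otimes>\<^bsub>G\<^esub> inv\<^bsub>G\<^esub> h) =
          \<alpha> (h \<otimes>\<^bsub>G\<^esub> g \<otimes>\<^bsub>G\<^esub> (inv\<^bsub>G\<^esub> g \<otimes>\<^bsub>G\<^esub> inv\<^bsub>G\<^esub> h))"
        using c rep_mult[OF rep, of "h \<otimes>\<^bsub>G\<^esub> g" "inv\<^bsub>G\<^esub> g \<otimes>\<^bsub>G\<^esub> inv\<^bsub>G\<^esub> h"] by simp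
      also have "h \<otimes>\<^bsub>G\<^esub> g \<otimes>\<^bsub>G\<^esub> (inv\<^bsub>G\<^esub> g \<otimes>\<^bsub>G\<^esub> inv\<^bsub>G\<^esub> h) = \<one>\<^bsub>G\<^esub>"
        using c G.r_inv[of "h \<otimes>\<^bsub>G\<^esub> g"] by (simp add: G.inv_mult_group)
      finally show "g \<otimes>\<^bsub>G\<^esub> h \<otimes>\<^bsub>G\<^esub> inv\<^bsub>G\<^esub> g \<otimes>\<^bsub>G\<^esub> inv\<^bsub>G\<^esub> h \<in> kernel G SL \<alpha>"
        using c by (simp add: kernel_def)
    qed
    \<comment> \<open>The kernel is a subgroup, so it is enough that it contains the generating
      commutators.\<close>
    then have "derived G ?D \<subseteq> kernel G SL \<alpha>"
      unfolding derived_def[of G ?D] using subgroup_kernel by (rule G.generate_subgroup_incl)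
    moreover have "derived G ?D \<lhd> G" by (intro G.derived_is_normal G.normal_self)
    ultimately obtain \<beta> where "\<beta> \<in> hom (G Mod derived G ?D) SL"
        "\<And>g. g \<in> carrier G \<Longrightarrow> \<beta> (derived G ?D #>\<^bsub>G\<^esub> g) = \<alpha> g"
      using FactGroup_universal_kernel by metis
    then have "\<exists>\<beta>\<in>hom (G Mod derived G ?D) SL. \<forall>g\<in>carrier G. \<alpha> g = \<beta> (derived G ?D #>\<^bsub>G\<^esub> g)"
      by metis
    then show "metabelian_rep G \<alpha>"
      using rep by (simp add: metabelian_rep_def D2)
  }
qed

text \<open>By \<open>ker\<close>, the kernel \<open>K\<close> of \<open>\<epsilon>\<close> is the
  commutator subgroup. Both conditions thus become statements about \<open>\<epsilon>\<close>: a
  trace identity, and commutation of \<open>\<alpha>\<close> on \<open>K\<close>.\<close>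

proposition fixed_character_iff_metabelian_rep:
  fixes \<alpha> :: "'g \<Rightarrow> complex^'n^'n"
  assumes G: "group G" and \<epsilon>: "\<epsilon> \<in> epi G integer_group"
    and ker: "kernel G integer_group \<epsilon> = derived G (carrier G)"
    and irr: "irreducible_rep G \<alpha>"
  shows "fixed_character TYPE('n) G \<epsilon> (character G \<alpha>) \<longleftrightarrow> metabelian_rep G \<alpha>"
proof -
  have rep: "\<alpha> \<in> rep_variety G" using irr by (simp add: irreducible_rep_def)
  have hom: "\<epsilon> \<in> hom G integer_group" and surj: "\<epsilon> ` carrier G = UNIV"
    using \<epsilon> by (auto simp: epi_def integer_group_def)
  \<comment> \<open>Surjectivity supplies an element to take the place of the meridian.\<close>
  obtain m where m: "m \<in> carrier G" "\<epsilon> m = 1" using surj by (metis UNIV_I imageE)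
  let ?\<omega> = "cis (2 * pi / real CARD('n))"
  interpret group G by (rule G)
  interpret integer_extension_rep G \<alpha> \<epsilon> m ?\<omega>
    by unfold_locales (use rep hom m in auto)
  show ?thesis
    unfolding fixed_character_iff[OF rep] metabelian_rep_iff_commute[OF G rep] ker[symmetric]
  proof (intro iffI ballI)
    fix g h assume fixed: "\<forall>g\<in>carrier G. ?\<omega> powi \<epsilon> g * trace (\<alpha> g) = trace (\<alpha> g)"
      and gh: "g \<in> K" "h \<in> K"
    have irr': "irreducible_rep G (rep_action \<epsilon> 1 \<alpha>)" by (rule irreducible_rep_action[OF irr hom])
    obtain A where A: "A \<noteq> 0" "\<And>g. g \<in> carrier G \<Longrightarrow> A ** \<alpha> g = rep_action \<epsilon> 1 \<alpha> g ** A"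
      by (rule same_character_intertwiner[OF G irr irr'])
        (use fixed in \<open>auto simp: trace_rep_action\<close>)
    show "\<alpha> g ** \<alpha> h = \<alpha> h ** \<alpha> g"
    proof (rule commute_of_intertwiner[OF _ _ gh])
      show "x = 0" if "A *v x = 0" for x by (rule intertwiner_injective[OF irr A that])
      show "A ** \<alpha> g = mat (?\<omega> powi \<epsilon> g) ** \<alpha> g ** A" if "g \<in> carrier G" for g
        using A(2)[OF that] by (simp add: rep_action_eq)
    qed
  next
    fix g assume "\<forall>g\<in>K. \<forall>h\<in>K. \<alpha> g ** \<alpha> h = \<alpha> h ** \<alpha> g" "g \<in> carrier G"
    then show "?\<omega> powi \<epsilon> g * trace (\<alpha> g) = trace (\<alpha> g)"
      using trace_of_commuting_kernel[OF irr] by blast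
  qed
qed

theorem theorem1:
  fixes S :: "'a topology"
    and k :: "complex \<Rightarrow> 'a"
    and T :: "complex \<times> complex \<Rightarrow> 'a"
    and x :: 'a
    and \<epsilon> :: "(real \<Rightarrow> 'a) set \<Rightarrow> int"
    and \<alpha> :: "(real \<Rightarrow> 'a) set \<Rightarrow> complex^'n^'n"
  defines "\<pi> \<equiv> fundamental_group (knot_exterior S T) x"
  assumes "integral_homology_3_sphere S"
    and "oriented_knot S k"
    and "tube S k T"
    and "x \<in> topspace (knot_exterior S T)"
    and "knot_abelianization S T x \<epsilon>"
    and "irreducible_rep \<pi> \<alpha>"
  shows "fixed_character TYPE('n) \<pi> \<epsilon> (character \<pi> \<alpha>) \<longleftrightarrow> metabelian_rep \<pi> \<alpha>"
proof -
  \<comment> \<open>The base point lies in the exterior, so the constant loop is an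
    identity.\<close>
  have "group \<pi>" using assms(5) unfolding \<pi>_def by (rule group_fundamental_group)
  moreover have "\<epsilon> \<in> epi \<pi> integer_group" "kernel \<pi> integer_group \<epsilon> = derived \<pi> (carrier \<pi>)"
    using assms(6) by (simp_all add: knot_abelianization_def \<pi>_def Let_def)
  ultimately show ?thesis using assms(7) by (intro fixed_character_iff_metabelian_rep)
qed

end
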